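(* The problem $\alpha$-$\textsc{VertexStability}$ is in $\mathrm{P}$ for co-graphs; that is, there is a deterministic polynomial-time algorithm that, given any co-graph $G$, decides whether $G$ is $\alpha$-vertex-stable.
   Context: Graphs are finite, undirected, simple, without loops. Co-graphs are defined recursively: a single-vertex graph $(\{v\},\emptyset)$ is a co-graph; if $G_1$ and $G_2$ are (vertex-disjoint) co-graphs, then so are their disjoint union $G_1\cup G_2$ and their join $G_1+G_2$ (the disjoint union together with all edges between $V(G_1)$ and $V(G_2)$). $\alpha(G)$ is the size of a maximum independent set. $G$ is $\alpha$-vertex-stable if $\alpha(G-v)=\alpha(G)$ for every $v\in V(G)$, where $G-v$ is $G$ with $v$ and its incident edges deleted; $\alpha$-$\textsc{VertexStability}$ is the set of $\alpha$-vertex-stable graphs. Running time is polynomial in the size of the encoding of $G$. *)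

theory Defs
  imports "HOL-Library.Ramsey" "HOL-Computational_Algebra.Polynomial"
begin

record 'a graph =
  verts :: "'a set"
  edges :: "'a set set"

definition simple_graph :: "'a graph \<Rightarrow> bool" where
  "simple_graph G \<longleftrightarrow>
     finite (verts G) \<and> (\<forall>e\<in>edges G. e \<subseteq> verts G \<and> card e = 2)"

definition disjoint_union :: "'a graph \<Rightarrow> 'a graph \<Rightarrow> 'a graph" where
  "disjoint_union G H = \<lparr>verts = verts G \<union> verts H, edges = edges G \<union> edges H\<rparr>"

definition join :: "'a graph \<Rightarrow> 'a graph \<Rightarrow> 'a graph" where
  "join G H =
     \<lparr>verts = verts G \<union> verts H,
      edges = edges G \<union> edges H \<union> {{u, v} |u v. u \<in> verts G \<and> v \<in> verts H}\<rparr>"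

inductive cograph :: "'a graph \<Rightarrow> bool" where
  single: "cograph \<lparr>verts = {v}, edges = {}\<rparr>"
| union: "cograph G \<Longrightarrow> cograph H \<Longrightarrow> verts G \<inter> verts H = {} \<Longrightarrow> cograph (disjoint_union G H)"
| join: "cograph G \<Longrightarrow> cograph H \<Longrightarrow> verts G \<inter> verts H = {} \<Longrightarrow> cograph (join G H)"

definition independence_number :: "'a graph \<Rightarrow> nat" where
  "independence_number G = Max (card ` {S. S \<subseteq> verts G \<and> indep S (edges G)})"

definition delete_vertex :: "'a graph \<Rightarrow> 'a \<Rightarrow> 'a graph" where
  "delete_vertex G v = \<lparr>verts = verts G - {v}, edges = {e \<in> edges G. v \<notin> e}\<rparr>"

definition alpha_vertex_stable :: "'a graph \<Rightarrow> bool" where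
  "alpha_vertex_stable G \<longleftrightarrow>
     (\<forall>v\<in>verts G. independence_number (delete_vertex G v) = independence_number G)"

definition alpha_VertexStability :: "'a graph set" where
  "alpha_VertexStability = {G. simple_graph G \<and> alpha_vertex_stable G}"

text \<open>
  States are the numbers below \<open>num_states\<close>, tape symbols the numbers below \<open>num_symbols\<close>.
  Symbol 0 is the blank; symbols 1 and 2 stand for the input bits 0 and 1.
  The transition function maps the current state and the list of scanned symbols (one for each
  tape) to the new state and, for each tape, the symbol to be written and the head movement.
\<close>

datatype move = Move_Left | Stay | Move_Right

record tm =
  num_tapes :: nat
  num_symbols :: nat
  num_states :: nat
  start_state :: nat
  accept_state :: nat
  reject_state :: nat
  transition :: "nat \<Rightarrow> nat list \<Rightarrow> nat \<times> (nat \<times> move) list"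

text \<open>The values of \<open>transition\<close> outside the finite domain considered here are irrelevant.\<close>

definition turing_machine :: "tm \<Rightarrow> bool" where
  "turing_machine M \<longleftrightarrow>
     num_tapes M \<ge> 1 \<and> num_symbols M \<ge> 3 \<and>
     start_state M < num_states M \<and> accept_state M < num_states M \<and>
     reject_state M < num_states M \<and> accept_state M \<noteq> reject_state M \<and>
     (\<forall>q < num_states M. \<forall>xs. length xs = num_tapes M \<and> (\<forall>x\<in>set xs. x < num_symbols M) \<longrightarrow>
        (case transition M q xs of (q', acts) \<Rightarrow>
           q' < num_states M \<and> length acts = num_tapes M \<and>
           (\<forall>(y, d)\<in>set acts. y < num_symbols M)))"

type_synonym tape = "(int \<Rightarrow> nat) \<times> int"
type_synonym config = "nat \<times> tape list"

definition scan :: "tape \<Rightarrow> nat" where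
  "scan = (\<lambda>(f, p). f p)"

fun offset :: "move \<Rightarrow> int" where
  "offset Move_Left = -1"
| "offset Stay = 0"
| "offset Move_Right = 1"

definition act :: "nat \<times> move \<Rightarrow> tape \<Rightarrow> tape" where
  "act = (\<lambda>(y, d) (f, p). (f(p := y), p + offset d))"

definition halted :: "tm \<Rightarrow> config \<Rightarrow> bool" where
  "halted M c \<longleftrightarrow> fst c = accept_state M \<or> fst c = reject_state M"

definition step :: "tm \<Rightarrow> config \<Rightarrow> config" where
  "step M c =
     (if halted M c then c
      else case c of (q, ts) \<Rightarrow>
        (case transition M q (map scan ts) of (q', acts) \<Rightarrow> (q', map2 act acts ts)))"

definition blank_tape :: tape where
  "blank_tape = (\<lambda>_. 0, 0)"

definition input_tape :: "bool list \<Rightarrow> tape" where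
  "input_tape w =
     (\<lambda>i. if 0 \<le> i \<and> i < int (length w) then (if w ! nat i then 2 else 1) else 0, 0)"

definition initial_config :: "tm \<Rightarrow> bool list \<Rightarrow> config" where
  "initial_config M w = (start_state M, input_tape w # replicate (num_tapes M - 1) blank_tape)"

text \<open>Since \<open>step\<close> does not change halted configurations, these say that \<open>M\<close> halts on input
  \<open>w\<close> after at most \<open>t\<close> steps, with the given verdict.\<close>

definition accepts_within :: "tm \<Rightarrow> bool list \<Rightarrow> nat \<Rightarrow> bool" where
  "accepts_within M w t \<longleftrightarrow> fst ((step M ^^ t) (initial_config M w)) = accept_state M"

definition rejects_within :: "tm \<Rightarrow> bool list \<Rightarrow> nat \<Rightarrow> bool" where
  "rejects_within M w t \<longleftrightarrow> fst ((step M ^^ t) (initial_config M w)) = reject_state M"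

text \<open>
  A graph with \<open>n\<close> vertices is encoded as \<open>1\<^sup>n 0\<close> followed by its adjacency matrix, row by row,
  with the vertices in increasing order. Every finite graph is isomorphic to one whose vertices
  are natural numbers.
\<close>

definition encode_graph :: "nat graph \<Rightarrow> bool list" where
  "encode_graph G =
     (let vs = sorted_list_of_set (verts G) in
        replicate (length vs) True @ [False] @
        concat (map (\<lambda>u. map (\<lambda>v. {u, v} \<in> edges G) vs) vs))"

text \<open>The problem \<open>A\<close> restricted to the graph class \<open>C\<close>: inputs are promised to encode graphs
  in \<open>C\<close>. The bound \<open>p\<close> is a polynomial in the length of the encoding.\<close>

definition in_P_for :: "nat graph set \<Rightarrow> nat graph set \<Rightarrow> bool" where
  "in_P_for A C \<longleftrightarrow>
     (\<exists>M. turing_machine M \<and>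
        (\<exists>p :: nat poly. \<forall>G\<in>C.
           let w = encode_graph G; t = poly p (length w) in
             (G \<in> A \<longrightarrow> accepts_within M w t) \<and> (G \<notin> A \<longrightarrow> rejects_within M w t)))"

end

theory Submission
  imports Defs
begin

text \<open>
  In an induced subgraph of a co-graph every maximal clique meets every maximal independent set, so
  removing a maximal clique lowers \<open>\<alpha>\<close> by exactly one. To compare \<open>\<alpha>(G - v)\<close> with \<open>\<alpha>(G)\<close>, repeatedly
  remove a greedily chosen maximal clique \<open>K\<close> of what is left of \<open>G - v\<close>. As long as \<open>v\<close> misses some
  vertex of \<open>K\<close>, the clique is also maximal in what is left of \<open>G\<close>, and both numbers drop by one. If
  \<open>v\<close> is adjacent to all of a nonempty \<open>K\<close>, then \<open>K \<union> {v}\<close> is maximal in what is left of \<open>G\<close>, and the two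
  numbers agree; if only \<open>v\<close> is left, then \<open>\<alpha>(G) = \<alpha>(G - v) + 1\<close>. Thus no counting is
  needed. One clique is found in a single sweep over the adjacency matrix, which a multitape machine
  with markers for the vertices performs in polynomial time.
\<close>

section \<open>Maximal cliques and independent sets in co-graphs\<close>

text \<open>The co-graph structure enters only through the meeting property. In a disjoint union a
  clique lies on one side, in a join an independent set does, and the trace of the other set on that
  side is still maximal there. The property is carried for all nonempty vertex subsets, because the
  greedy removal uses it again for every remainder. The edge set stays fixed while the vertex subset
  shrinks, so that deleting vertices is plain set difference. Membership in P demands a concrete
  machine. Its transition table is never written out: a small language of structured programs with
  timed triples is compiled into one. Since there are no variables, the clique, the removed
  vertices, the candidate \<open>v\<close> and the vertex of the current row are all kept as marks
  on tapes, and running onto a blank replaces every counter.\<close>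

definition maximal_clique :: "'a set set \<Rightarrow> 'a set \<Rightarrow> 'a set \<Rightarrow> bool" where
  "maximal_clique E W K \<longleftrightarrow> K \<subseteq> W \<and> clique K E \<and> (\<forall>x\<in>W - K. \<exists>y\<in>K. {x, y} \<notin> E)"

definition maximal_indep :: "'a set set \<Rightarrow> 'a set \<Rightarrow> 'a set \<Rightarrow> bool" where
  "maximal_indep E W S \<longleftrightarrow> S \<subseteq> W \<and> indep S E \<and> (\<forall>x\<in>W - S. \<exists>y\<in>S. {x, y} \<in> E)"

definition cliques_meet_indeps :: "'a set set \<Rightarrow> 'a set \<Rightarrow> bool" where
  "cliques_meet_indeps E V \<longleftrightarrow>
     (\<forall>W K S. W \<subseteq> V \<and> W \<noteq> {} \<and> maximal_clique E W K \<and> maximal_indep E W S \<longrightarrow> K \<inter> S \<noteq> {})"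

lemma cograph_edge:
  assumes "cograph G" "e \<in> edges G"
  shows "e \<subseteq> verts G \<and> card e = 2"
  using assms
proof (induction arbitrary: e)
  case (join G H)
  have "card {u, v} = 2" if "u \<in> verts G" "v \<in> verts H" for u v
    using that join.hyps(3) by (subst card_2_iff) blast
  with join show ?case by (fastforce simp: join_def)
qed (auto simp: disjoint_union_def)

lemma cograph_finite: "cograph G \<Longrightarrow> finite (verts G)"
  by (induction rule: cograph.induct) (auto simp: disjoint_union_def join_def)

lemma cograph_nonempty: "cograph G \<Longrightarrow> verts G \<noteq> {}"
  by (induction rule: cograph.induct) (auto simp: disjoint_union_def join_def)

lemma cograph_simple: "cograph G \<Longrightarrow> simple_graph G"
  by (simp add: simple_graph_def cograph_finite cograph_edge)

text \<open>The witnesses of maximality lie in \<open>K\<close> itself, so they survive shrinking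
  \<open>W\<close> to any \<open>U\<close> that still contains \<open>K\<close>. Agreement of
  \<open>E\<close> and \<open>F\<close> on \<open>U\<close> suffices, so the lemma serves both for
  passing to one side of a union and for changing the edge set.\<close>

lemma maximal_clique_mono:
  assumes "maximal_clique E W K" "U \<subseteq> W" "K \<subseteq> U"
    and "\<And>x y. x \<in> U \<Longrightarrow> y \<in> U \<Longrightarrow> {x, y} \<in> E \<longleftrightarrow> {x, y} \<in> F"
  shows "maximal_clique F U K"
  unfolding maximal_clique_def clique_def
proof (intro conjI ballI impI)
  show "{x, y} \<in> F" if "x \<in> K" "y \<in> K" "x \<noteq> y" for x y
  proof -
    have "x \<in> U" "y \<in> U" using that assms(3) by auto
    then show ?thesis
      using assms(1) that assms(4)[of x y] by (simp add: maximal_clique_def clique_def)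
  qed
  show "\<exists>y\<in>K. {x, y} \<notin> F" if "x \<in> U - K" for x
  proof -
    have "x \<in> W - K" using that assms(2) by blast
    then obtain y where "y \<in> K" "{x, y} \<notin> E"
      using assms(1) by (auto simp: maximal_clique_def)
    with assms(3) assms(4)[of x y] that show ?thesis by blast
  qed
qed (rule assms(3))

lemma maximal_indep_mono:
  assumes "maximal_indep E W K" "U \<subseteq> W" "K \<subseteq> U"
    and "\<And>x y. x \<in> U \<Longrightarrow> y \<in> U \<Longrightarrow> {x, y} \<in> E \<longleftrightarrow> {x, y} \<in> F"
  shows "maximal_indep F U K"
  unfolding maximal_indep_def indep_def
proof (intro conjI ballI impI)
  show "{x, y} \<notin> F" if "x \<in> K" "y \<in> K" "x \<noteq> y" for x y
  proof -
    have "x \<in> U" "y \<in> U" using that assms(3) by auto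
    then show ?thesis
      using assms(1) that assms(4)[of x y] by (simp add: maximal_indep_def indep_def)
  qed
  show "\<exists>y\<in>K. {x, y} \<in> F" if "x \<in> U - K" for x
  proof -
    have "x \<in> W - K" using that assms(2) by blast
    then obtain y where "y \<in> K" "{x, y} \<in> E"
      using assms(1) by (auto simp: maximal_indep_def)
    with assms(3) assms(4)[of x y] that show ?thesis by blast
  qed
qed (rule assms(3))

text \<open>Here \<open>K\<close> may stick out of \<open>A\<close>. A vertex of \<open>A\<close> is
  adjacent to all of \<open>W - A\<close>, so its non-neighbour in \<open>K\<close> must lie in
  \<open>K \<inter> A\<close>.\<close>

lemma maximal_clique_Int:
  assumes "maximal_clique E W K"
    and "\<And>x y. x \<in> W \<inter> A \<Longrightarrow> y \<in> W - A \<Longrightarrow> {x, y} \<in> E"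
  shows "maximal_clique E (W \<inter> A) (K \<inter> A)"
  unfolding maximal_clique_def
proof (intro conjI ballI)
  show "\<exists>y\<in>K \<inter> A. {x, y} \<notin> E" if "x \<in> W \<inter> A - K \<inter> A" for x
    using assms that unfolding maximal_clique_def by blast
qed (use assms in \<open>auto simp: maximal_clique_def clique_def\<close>)

lemma maximal_indep_Int:
  assumes "maximal_indep E W K"
    and "\<And>x y. x \<in> W \<inter> A \<Longrightarrow> y \<in> W - A \<Longrightarrow> {x, y} \<notin> E"
  shows "maximal_indep E (W \<inter> A) (K \<inter> A)"
  unfolding maximal_indep_def
proof (intro conjI ballI)
  show "\<exists>y\<in>K \<inter> A. {x, y} \<in> E" if "x \<in> W \<inter> A - K \<inter> A" for x
    using assms that unfolding maximal_indep_def by blast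
qed (use assms in \<open>auto simp: maximal_indep_def indep_def\<close>)

lemma maximal_clique_nonempty: "maximal_clique E W K \<Longrightarrow> W \<noteq> {} \<Longrightarrow> K \<noteq> {}"
  unfolding maximal_clique_def by blast

lemma maximal_indep_nonempty: "maximal_indep E W K \<Longrightarrow> W \<noteq> {} \<Longrightarrow> K \<noteq> {}"
  unfolding maximal_indep_def by blast

text \<open>Two clique members on different sides would be adjacent, so \<open>K\<close> is confined
  to one side. \<open>S\<close> may spread over both, but its part on that side is maximal there, as
  domination never crosses sides.\<close>

lemma cliques_meet_indeps_union:
  assumes A: "cliques_meet_indeps E A" and B: "cliques_meet_indeps E B"
    and no: "\<And>x y. x \<in> A \<Longrightarrow> y \<in> B \<Longrightarrow> {x, y} \<notin> E" and disj: "A \<inter> B = {}"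
  shows "cliques_meet_indeps E (A \<union> B)"
  unfolding cliques_meet_indeps_def
proof (intro allI impI, elim conjE)
  fix W K S assume W: "W \<subseteq> A \<union> B" "W \<noteq> {}" and K: "maximal_clique E W K" and S: "maximal_indep E W S"
  have no': "{y, x} \<notin> E" if "x \<in> A" "y \<in> B" for x y using no[OF that] by (simp add: insert_commute)
  obtain k where k: "k \<in> K" using maximal_clique_nonempty[OF K W(2)] by blast
  have KW: "K \<subseteq> W" and cl: "clique K E" using K by (auto simp: maximal_clique_def)
  have "K \<subseteq> A \<or> K \<subseteq> B"
  proof (rule ccontr)
    assume "\<not> (K \<subseteq> A \<or> K \<subseteq> B)"
    then obtain x y where "x \<in> K" "x \<in> A" "y \<in> K" "y \<in> B" using KW W(1) by blast
    moreover from this have "x \<noteq> y" using disj by blast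
    ultimately show False using no cl unfolding clique_def by blast
  qed
  moreover have "K \<inter> S \<noteq> {}" if "K \<subseteq> A"
  proof -
    have "maximal_clique E (W \<inter> A) K" by (rule maximal_clique_mono[OF K]) (use KW that in auto)
    moreover have "maximal_indep E (W \<inter> A) (S \<inter> A)"
      by (rule maximal_indep_Int[OF S]) (use no W in blast)
    moreover have "W \<inter> A \<noteq> {}" using k KW that by blast
    ultimately show ?thesis using A unfolding cliques_meet_indeps_def by blast
  qed
  moreover have "K \<inter> S \<noteq> {}" if "K \<subseteq> B"
  proof -
    have "maximal_clique E (W \<inter> B) K" by (rule maximal_clique_mono[OF K]) (use KW that in auto)
    moreover have "maximal_indep E (W \<inter> B) (S \<inter> B)"
      by (rule maximal_indep_Int[OF S]) (use no' W in blast)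
    moreover have "W \<inter> B \<noteq> {}" using k KW that by blast
    ultimately show ?thesis using B unfolding cliques_meet_indeps_def by blast
  qed
  ultimately show "K \<inter> S \<noteq> {}" by blast
qed

text \<open>The complementary argument: now \<open>S\<close> is confined to one side and
  \<open>K\<close> is cut down to it.\<close>

lemma cliques_meet_indeps_join:
  assumes A: "cliques_meet_indeps E A" and B: "cliques_meet_indeps E B"
    and yes: "\<And>x y. x \<in> A \<Longrightarrow> y \<in> B \<Longrightarrow> {x, y} \<in> E" and disj: "A \<inter> B = {}"
  shows "cliques_meet_indeps E (A \<union> B)"
  unfolding cliques_meet_indeps_def
proof (intro allI impI, elim conjE)
  fix W K S assume W: "W \<subseteq> A \<union> B" "W \<noteq> {}" and K: "maximal_clique E W K" and S: "maximal_indep E W S"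
  have yes': "{y, x} \<in> E" if "x \<in> A" "y \<in> B" for x y using yes[OF that] by (simp add: insert_commute)
  obtain k where k: "k \<in> S" using maximal_indep_nonempty[OF S W(2)] by blast
  have SW: "S \<subseteq> W" and cl: "indep S E" using S by (auto simp: maximal_indep_def)
  have "S \<subseteq> A \<or> S \<subseteq> B"
  proof (rule ccontr)
    assume "\<not> (S \<subseteq> A \<or> S \<subseteq> B)"
    then obtain x y where "x \<in> S" "x \<in> A" "y \<in> S" "y \<in> B" using SW W(1) by blast
    moreover from this have "x \<noteq> y" using disj by blast
    ultimately show False using yes cl unfolding indep_def by blast
  qed
  moreover have "K \<inter> S \<noteq> {}" if "S \<subseteq> A"
  proof -
    have "maximal_indep E (W \<inter> A) S" by (rule maximal_indep_mono[OF S]) (use SW that in auto)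
    moreover have "maximal_clique E (W \<inter> A) (K \<inter> A)"
      by (rule maximal_clique_Int[OF K]) (use yes W in blast)
    moreover have "W \<inter> A \<noteq> {}" using k SW that by blast
    ultimately show ?thesis using A unfolding cliques_meet_indeps_def by blast
  qed
  moreover have "K \<inter> S \<noteq> {}" if "S \<subseteq> B"
  proof -
    have "maximal_indep E (W \<inter> B) S" by (rule maximal_indep_mono[OF S]) (use SW that in auto)
    moreover have "maximal_clique E (W \<inter> B) (K \<inter> B)"
      by (rule maximal_clique_Int[OF K]) (use yes' W in blast)
    moreover have "W \<inter> B \<noteq> {}" using k SW that by blast
    ultimately show ?thesis using B unfolding cliques_meet_indeps_def by blast
  qed
  ultimately show "K \<inter> S \<noteq> {}" by blast
qed

lemma cliques_meet_indeps_cong: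
  assumes "cliques_meet_indeps E V" and "\<And>x y. x \<in> V \<Longrightarrow> y \<in> V \<Longrightarrow> {x, y} \<in> E \<longleftrightarrow> {x, y} \<in> F"
  shows "cliques_meet_indeps F V"
  unfolding cliques_meet_indeps_def
proof (intro allI impI, elim conjE)
  fix W K S assume W: "W \<subseteq> V" "W \<noteq> {}" and K: "maximal_clique F W K" and S: "maximal_indep F W S"
  have eq: "{x, y} \<in> F \<longleftrightarrow> {x, y} \<in> E" if "x \<in> W" "y \<in> W" for x y
    using that assms(2) W(1) by blast
  have "maximal_clique E W K" "maximal_indep E W S"
    by (rule maximal_clique_mono[OF K] maximal_indep_mono[OF S];
        use K S eq in \<open>auto simp: maximal_clique_def maximal_indep_def\<close>)+
  then show "K \<inter> S \<noteq> {}" using assms(1) W unfolding cliques_meet_indeps_def by blast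
qed

lemma cograph_cliques_meet_indeps: "cograph G \<Longrightarrow> cliques_meet_indeps (edges G) (verts G)"
proof (induction rule: cograph.induct)
  case (single v)
  have "v \<in> K \<inter> S" if "W \<subseteq> {v}" "W \<noteq> {}" "maximal_clique {} W K" "maximal_indep {} W S" for W K S
    using that maximal_clique_nonempty[OF that(3,2)] maximal_indep_nonempty[OF that(4,2)]
    by (auto simp: maximal_clique_def maximal_indep_def)
  then have "cliques_meet_indeps {} {v}"
    unfolding cliques_meet_indeps_def by (metis emptyE)
  then show ?case by simp
next
  case (union G H)
  have G: "{x, y} \<notin> edges H" if "x \<in> verts G" for x y
    using cograph_edge[OF union.hyps(2), of "{x, y}"] that union.hyps(3) by auto
  have H: "{x, y} \<notin> edges G" if "y \<in> verts H" for x y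
    using cograph_edge[OF union.hyps(1), of "{x, y}"] that union.hyps(3) by auto
  have H': "{x, y} \<notin> edges G" if "x \<in> verts H" for x y
    using cograph_edge[OF union.hyps(1), of "{x, y}"] that union.hyps(3) by auto
  have "cliques_meet_indeps (edges G \<union> edges H) (verts G \<union> verts H)"
  proof (rule cliques_meet_indeps_union)
    show "cliques_meet_indeps (edges G \<union> edges H) (verts G)"
      by (rule cliques_meet_indeps_cong[OF union.IH(1)]) (use G in auto)
    show "cliques_meet_indeps (edges G \<union> edges H) (verts H)"
      by (rule cliques_meet_indeps_cong[OF union.IH(2)]) (use H' in auto)
  qed (use G H union.hyps in auto)
  then show ?case by (simp add: disjoint_union_def)
next
  case (join G H)
  have G: "{x, y} \<notin> edges H" if "x \<in> verts G" for x y
    using cograph_edge[OF join.hyps(2), of "{x, y}"] that join.hyps(3) by auto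
  have H: "{x, y} \<notin> edges G" if "x \<in> verts H" for x y
    using cograph_edge[OF join.hyps(1), of "{x, y}"] that join.hyps(3) by auto
  let ?J = "{{u, v} |u v. u \<in> verts G \<and> v \<in> verts H}"
  have JG: "{x, y} \<notin> ?J" if "x \<in> verts G" "y \<in> verts G" for x y
    using that join.hyps(3) by (auto simp: doubleton_eq_iff)
  have JH: "{x, y} \<notin> ?J" if "x \<in> verts H" "y \<in> verts H" for x y
    using that join.hyps(3) by (auto simp: doubleton_eq_iff)
  have "cliques_meet_indeps (edges G \<union> edges H \<union> ?J) (verts G \<union> verts H)"
  proof (rule cliques_meet_indeps_join)
    show "cliques_meet_indeps (edges G \<union> edges H \<union> ?J) (verts G)"
      by (rule cliques_meet_indeps_cong[OF join.IH(1)]) (use G JG in blast)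
    show "cliques_meet_indeps (edges G \<union> edges H \<union> ?J) (verts H)"
      by (rule cliques_meet_indeps_cong[OF join.IH(2)]) (use H JH in blast)
  qed (use join.hyps in auto)
  then show ?case by (simp add: join_def)
qed

section \<open>Independence numbers of vertex subsets under clique removal\<close>

definition alpha_on :: "'a set set \<Rightarrow> 'a set \<Rightarrow> nat" where
  "alpha_on E W = Max (card ` {S. S \<subseteq> W \<and> indep S E})"

lemma independence_number_alpha_on: "independence_number G = alpha_on (edges G) (verts G)"
  by (simp add: independence_number_def alpha_on_def)

lemma alpha_on_ge: "finite W \<Longrightarrow> S \<subseteq> W \<Longrightarrow> indep S E \<Longrightarrow> card S \<le> alpha_on E W"
  unfolding alpha_on_def by (rule Max_ge) auto

lemma alpha_on_attained:
  assumes "finite W"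
  obtains S where "S \<subseteq> W" "indep S E" "card S = alpha_on E W"
proof -
  have "{} \<in> {S. S \<subseteq> W \<and> indep S E}" by (simp add: indep_def)
  then have "alpha_on E W \<in> card ` {S. S \<subseteq> W \<and> indep S E}"
    unfolding alpha_on_def using assms by (intro Max_in) auto
  then show thesis using that by auto
qed

lemma maximum_indep_is_maximal:
  assumes "finite W" "S \<subseteq> W" "indep S E" "card S = alpha_on E W"
  shows "maximal_indep E W S"
  unfolding maximal_indep_def
proof (intro conjI ballI assms, rule ccontr)
  fix x assume x: "x \<in> W - S" and "\<not> (\<exists>y\<in>S. {x, y} \<in> E)"
  then have "indep (insert x S) E"
    using assms(3) by (auto simp: indep_def insert_commute)
  then have "card (insert x S) \<le> alpha_on E W"
    using x assms by (intro alpha_on_ge) auto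
  with x assms finite_subset[OF assms(2,1)] show False by auto
qed

text \<open>An independent set loses at most one vertex with \<open>K\<close>. Conversely, if a set
  \<open>T\<close> avoiding \<open>K\<close> were maximum in \<open>W\<close>, it would be maximal
  there and hence have to meet \<open>K\<close>.\<close>

lemma alpha_on_remove_clique:
  assumes "finite V" "cliques_meet_indeps E V" "W \<subseteq> V" "W \<noteq> {}" "maximal_clique E W K"
  shows "alpha_on E W = alpha_on E (W - K) + 1"
proof (rule antisym)
  have fin: "finite W" using assms finite_subset by blast
  obtain S where S: "S \<subseteq> W" "indep S E" "card S = alpha_on E W"
    using alpha_on_attained[OF fin] .
  have "S \<inter> K \<subseteq> {x}" if "x \<in> S \<inter> K" for x
    using that S(2) assms(5) unfolding indep_def maximal_clique_def clique_def by blast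
  then obtain x where "S \<inter> K \<subseteq> {x}" by blast
  then have le1: "card (S \<inter> K) \<le> 1"
    using card_mono[of "{x}" "S \<inter> K"] by simp
  have "card (S - K) \<le> alpha_on E (W - K)"
    using S fin by (intro alpha_on_ge) (auto simp: indep_def)
  then show "alpha_on E W \<le> alpha_on E (W - K) + 1"
    using card_Int_Diff[of S K] finite_subset[OF S(1) fin] S(3) le1 by linarith
  obtain T where T: "T \<subseteq> W - K" "indep T E" "card T = alpha_on E (W - K)"
    using alpha_on_attained[of "W - K"] fin by blast
  have "card T \<noteq> alpha_on E W"
  proof
    assume "card T = alpha_on E W"
    then have "maximal_indep E W T"
      using T fin by (intro maximum_indep_is_maximal) auto
    with assms have "K \<inter> T \<noteq> {}" unfolding cliques_meet_indeps_def by blast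
    with T show False by blast
  qed
  moreover have "card T \<le> alpha_on E W" using T fin by (intro alpha_on_ge) auto
  ultimately show "alpha_on E (W - K) + 1 \<le> alpha_on E W" using T by linarith
qed

lemma alpha_on_empty [simp]: "alpha_on E {} = 0"
  by (simp add: alpha_on_def indep_def)

lemma alpha_on_singleton [simp]: "alpha_on E {v} = 1"
proof -
  have "{S. S \<subseteq> {v} \<and> indep S E} = {{}, {v}}"
    by (auto simp: indep_def)
  then show ?thesis by (simp add: alpha_on_def)
qed

lemma alpha_on_delete_vertex:
  "independence_number (delete_vertex G v) = alpha_on (edges G) (verts G - {v})"
proof -
  have "indep S {e \<in> edges G. v \<notin> e} \<longleftrightarrow> indep S (edges G)" if "S \<subseteq> verts G - {v}" for S
    using that by (auto simp: indep_def)
  then have "{S. S \<subseteq> verts G - {v} \<and> indep S {e \<in> edges G. v \<notin> e}} =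
      {S. S \<subseteq> verts G - {v} \<and> indep S (edges G)}" by blast
  then show ?thesis by (simp add: independence_number_alpha_on delete_vertex_def alpha_on_def)
qed

text \<open>Used with \<open>f\<close> sending a row index of the adjacency matrix to its vertex.
  The machine sees only these indices, so the graph is moved onto them.\<close>

definition pullback_edges :: "('b \<Rightarrow> 'a) \<Rightarrow> 'a set set \<Rightarrow> 'b set set" where
  "pullback_edges f E = {{i, j} |i j. {f i, f j} \<in> E}"

lemma in_pullback_edges [simp]: "{i, j} \<in> pullback_edges f E \<longleftrightarrow> {f i, f j} \<in> E"
  by (auto simp: pullback_edges_def doubleton_eq_iff insert_commute)

lemma indep_image:
  assumes "inj_on f S"
  shows "indep (f ` S) E \<longleftrightarrow> indep S (pullback_edges f E)"
  using assms by (auto simp: indep_def inj_on_def)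

lemma clique_image:
  assumes "inj_on f S"
  shows "clique (f ` S) E \<longleftrightarrow> clique S (pullback_edges f E)"
  using assms by (auto simp: clique_def inj_on_def)

lemma alpha_on_image:
  assumes "inj_on f W"
  shows "alpha_on E (f ` W) = alpha_on (pullback_edges f E) W"
proof -
  have "card ` {S. S \<subseteq> f ` W \<and> indep S E} = card ` {S. S \<subseteq> W \<and> indep S (pullback_edges f E)}"
    (is "?A = ?B")
  proof (intro subset_antisym subsetI)
    fix k assume "k \<in> ?A"
    then obtain S where S: "S \<subseteq> W" "k = card (f ` S)" "indep (f ` S) E"
      by (auto simp: subset_image_iff)
    then show "k \<in> ?B"
      using indep_image[OF inj_on_subset[OF assms S(1)]] card_image[OF inj_on_subset[OF assms S(1)]]
      by auto
  next
    fix k assume "k \<in> ?B"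
    then obtain S where S: "S \<subseteq> W" "k = card S" "indep S (pullback_edges f E)" by auto
    then have "indep (f ` S) E" "k = card (f ` S)"
      using indep_image[OF inj_on_subset[OF assms S(1)]] card_image[OF inj_on_subset[OF assms S(1)]]
      by auto
    then show "k \<in> ?A" using S(1) by (intro image_eqI[of _ _ "f ` S"]) auto
  qed
  then show ?thesis by (simp add: alpha_on_def)
qed

lemma cliques_meet_indeps_pullback:
  assumes "cliques_meet_indeps E (f ` V)" "inj_on f V"
  shows "cliques_meet_indeps (pullback_edges f E) V"
  unfolding cliques_meet_indeps_def
proof (intro allI impI, elim conjE)
  fix W K S
  assume W: "W \<subseteq> V" "W \<noteq> {}" and K: "maximal_clique (pullback_edges f E) W K"
    and S: "maximal_indep (pullback_edges f E) W S"
  have sub: "K \<subseteq> V" "S \<subseteq> V" using K S W by (auto simp: maximal_clique_def maximal_indep_def)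
  have "maximal_clique E (f ` W) (f ` K)"
    using K clique_image[OF inj_on_subset[OF assms(2) sub(1)]]
    by (auto simp: maximal_clique_def)
  moreover have "maximal_indep E (f ` W) (f ` S)"
    using S indep_image[OF inj_on_subset[OF assms(2) sub(2)]]
    by (auto simp: maximal_indep_def)
  moreover have "f ` W \<subseteq> f ` V" "f ` W \<noteq> {}" using W by auto
  ultimately have "f ` K \<inter> f ` S \<noteq> {}" using assms(1) unfolding cliques_meet_indeps_def by blast
  then show "K \<inter> S \<noteq> {}"
    using inj_on_image_Int[OF assms(2) sub] by auto
qed

section \<open>Structured programs for Turing machines\<close>

text \<open>Actions and tests are arbitrary functions of the scanned symbols. Only control flow is
  syntax, because control flow is what has to become a finite state set.\<close>

datatype prog =
  Do "nat list \<Rightarrow> (nat \<times> move) list"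
| Seq prog prog
| Cond "nat list \<Rightarrow> bool" prog prog
| Loop "nat list \<Rightarrow> bool" prog

definition idle :: "nat list \<Rightarrow> (nat \<times> move) list" where
  "idle xs = map (\<lambda>x. (x, Stay)) xs"

text \<open>A program state is a stack of programs still to be run. Unfolding a construct costs one
  step with idle heads, so each application corresponds to exactly one machine transition.\<close>

fun advance :: "prog list \<Rightarrow> nat list \<Rightarrow> prog list \<times> (nat \<times> move) list" where
  "advance [] xs = ([], idle xs)"
| "advance (Do f # k) xs = (k, f xs)"
| "advance (Seq p q # k) xs = (p # q # k, idle xs)"
| "advance (Cond c p q # k) xs = ((if c xs then p else q) # k, idle xs)"
| "advance (Loop c p # k) xs = (if c xs then p # Loop c p # k else k, idle xs)"

fun run_step :: "prog list \<times> tape list \<Rightarrow> prog list \<times> tape list" where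
  "run_step (k, ts) = (case advance k (map scan ts) of (k', acts) \<Rightarrow> (k', map2 act acts ts))"

lemma act_idle [simp]: "map2 act (idle (map scan ts)) ts = ts"
  by (induction ts) (auto simp: idle_def act_def scan_def)

text \<open>Total correctness within \<open>B\<close> steps. Quantifying over every continuation
  \<open>k\<close> makes the triples composable.\<close>

definition triple :: "prog \<Rightarrow> tape list \<Rightarrow> nat \<Rightarrow> (tape list \<Rightarrow> bool) \<Rightarrow> bool" where
  "triple p ts B Q \<longleftrightarrow> (\<forall>k. \<exists>t\<le>B. \<exists>ts'. (run_step ^^ t) (p # k, ts) = (k, ts') \<and> Q ts')"

lemma funpow_trans: "(f ^^ s) x = y \<Longrightarrow> (f ^^ t) y = z \<Longrightarrow> (f ^^ (s + t)) x = z"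
  by (simp add: funpow_add add.commute[of s])

lemma triple_conseq:
  assumes "triple p ts B Q" "B \<le> B'" "\<And>ts'. Q ts' \<Longrightarrow> Q' ts'"
  shows "triple p ts B' Q'"
  using assms unfolding triple_def by (meson le_trans)

lemma triple_Do:
  assumes "Q (map2 act (f (map scan ts)) ts)"
  shows "triple (Do f) ts 1 Q"
  unfolding triple_def
proof
  fix k
  have "(run_step ^^ 1) (Do f # k, ts) = (k, map2 act (f (map scan ts)) ts)" by simp
  with assms show "\<exists>t\<le>1. \<exists>ts'. (run_step ^^ t) (Do f # k, ts) = (k, ts') \<and> Q ts'" by blast
qed

lemma triple_Seq:
  assumes p: "triple p ts B R" and q: "\<And>ts'. R ts' \<Longrightarrow> triple q ts' C Q"
  shows "triple (Seq p q) ts (B + C + 1) Q"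
  unfolding triple_def
proof
  fix k
  obtain t1 ts1 where 1: "t1 \<le> B" "(run_step ^^ t1) (p # q # k, ts) = (q # k, ts1)" "R ts1"
    using p unfolding triple_def by blast
  obtain t2 ts2 where 2: "t2 \<le> C" "(run_step ^^ t2) (q # k, ts1) = (k, ts2)" "Q ts2"
    using q[OF 1(3)] unfolding triple_def by blast
  have "(run_step ^^ 1) (Seq p q # k, ts) = (p # q # k, ts)" by simp
  from funpow_trans[OF funpow_trans[OF this 1(2)] 2(2)]
  have "(run_step ^^ (1 + t1 + t2)) (Seq p q # k, ts) = (k, ts2)" .
  moreover have "1 + t1 + t2 \<le> B + C + 1" using 1 2 by simp
  ultimately show "\<exists>t\<le>B + C + 1. \<exists>ts'. (run_step ^^ t) (Seq p q # k, ts) = (k, ts') \<and> Q ts'"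
    using 2(3) by blast
qed

lemma triple_Cond:
  assumes "c (map scan ts) \<Longrightarrow> triple p ts B Q" "\<not> c (map scan ts) \<Longrightarrow> triple q ts B Q"
  shows "triple (Cond c p q) ts (B + 1) Q"
  unfolding triple_def
proof
  fix k
  have "\<exists>t\<le>B. \<exists>ts'. (run_step ^^ t) ((if c (map scan ts) then p else q) # k, ts) = (k, ts') \<and> Q ts'"
    using assms unfolding triple_def by (cases "c (map scan ts)") auto
  then obtain t ts' where t: "t \<le> B" "Q ts'"
    "(run_step ^^ t) ((if c (map scan ts) then p else q) # k, ts) = (k, ts')" by blast
  have "(run_step ^^ 1) (Cond c p q # k, ts) = ((if c (map scan ts) then p else q) # k, ts)" by simp
  from funpow_trans[OF this t(3)]
  have "(run_step ^^ (1 + t)) (Cond c p q # k, ts) = (k, ts')" .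
  moreover have "1 + t \<le> B + 1" using t by simp
  ultimately show "\<exists>t\<le>B + 1. \<exists>ts'. (run_step ^^ t) (Cond c p q # k, ts) = (k, ts') \<and> Q ts'"
    using t(2) by blast
qed

text \<open>The index \<open>n\<close> of the invariant is a variant: each round lowers it, so at
  most \<open>n\<close> rounds occur. Each is charged \<open>B\<close> plus one step for its test;
  the extra factor pays for the failing test.\<close>

lemma triple_Loop:
  assumes "I n ts"
    and exit: "\<And>n ts. I n ts \<Longrightarrow> \<not> c (map scan ts) \<Longrightarrow> Q ts"
    and body: "\<And>n ts. I n ts \<Longrightarrow> c (map scan ts) \<Longrightarrow> triple p ts B (\<lambda>ts'. \<exists>m<n. I m ts')"
  shows "triple (Loop c p) ts ((n + 1) * (B + 1)) Q"
  unfolding triple_def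
proof
  fix k
  show "\<exists>t\<le>(n + 1) * (B + 1). \<exists>ts'. (run_step ^^ t) (Loop c p # k, ts) = (k, ts') \<and> Q ts'"
    using assms(1)
  proof (induction n arbitrary: ts rule: less_induct)
    case (less n)
    show ?case
    proof (cases "c (map scan ts)")
      case False
      then have "(run_step ^^ 1) (Loop c p # k, ts) = (k, ts)" by simp
      moreover have "1 \<le> (n + 1) * (B + 1)" by simp
      ultimately show ?thesis using exit[OF less.prems False] by blast
    next
      case True
      obtain t m ts' where t: "t \<le> B" "m < n" "I m ts'"
        "(run_step ^^ t) (p # Loop c p # k, ts) = (Loop c p # k, ts')"
        using body[OF less.prems True] unfolding triple_def by blast
      obtain t' ts'' where t': "t' \<le> (m + 1) * (B + 1)" "Q ts''"
        "(run_step ^^ t') (Loop c p # k, ts') = (k, ts'')"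
        using less.IH[OF t(2,3)] by blast
      have "(run_step ^^ 1) (Loop c p # k, ts) = (p # Loop c p # k, ts)" using True by simp
      from funpow_trans[OF funpow_trans[OF this t(4)] t'(3)]
      have "(run_step ^^ (1 + t + t')) (Loop c p # k, ts) = (k, ts'')" .
      moreover have "(m + 1) * (B + 1) \<le> n * (B + 1)"
        using t(2) by (intro mult_le_mono1) simp
      then have "1 + t + t' \<le> (n + 1) * (B + 1)"
        using t(1) t'(1) by simp
      ultimately show ?thesis using t'(2) by blast
    qed
  qed
qed

text \<open>The continuations that can occur while \<open>p\<close> runs with continuation \<open>k\<close>. They become the
  states of the compiled machine.\<close>

fun conts :: "prog \<Rightarrow> prog list \<Rightarrow> prog list set" where
  "conts (Do f) k = {Do f # k}"
| "conts (Seq p q) k = {Seq p q # k} \<union> conts p (q # k) \<union> conts q k"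
| "conts (Cond c p q) k = {Cond c p q # k} \<union> conts p k \<union> conts q k"
| "conts (Loop c p) k = {Loop c p # k} \<union> conts p (Loop c p # k)"

lemma finite_conts: "finite (conts p k)"
  by (induction p k rule: conts.induct) auto

lemma conts_start: "p # k \<in> conts p k"
  by (cases p) auto

text \<open>The closure that keeps the machine finite: a loop reappears as the continuation of its
  own body, so iterating never creates new stacks.\<close>

lemma conts_advance: "s \<in> conts p k \<Longrightarrow> fst (advance s xs) \<in> insert k (conts p k)"
  by (induction p k rule: conts.induct) (auto simp: conts_start split: if_splits)

fun well_formed :: "nat \<Rightarrow> nat \<Rightarrow> prog \<Rightarrow> bool" where
  "well_formed r b (Do f) \<longleftrightarrow> (\<forall>xs. length xs = r \<and> (\<forall>x\<in>set xs. x < b) \<longrightarrow>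
     length (f xs) = r \<and> (\<forall>(y, d)\<in>set (f xs). y < b))"
| "well_formed r b (Seq p q) \<longleftrightarrow> well_formed r b p \<and> well_formed r b q"
| "well_formed r b (Cond c p q) \<longleftrightarrow> well_formed r b p \<and> well_formed r b q"
| "well_formed r b (Loop c p) \<longleftrightarrow> well_formed r b p"

lemma advance_well_formed:
  assumes "\<forall>p\<in>set s. well_formed r b p" "length xs = r" "\<forall>x\<in>set xs. x < b"
  shows "length (snd (advance s xs)) = r \<and> (\<forall>(y, d)\<in>set (snd (advance s xs)). y < b)"
  using assms by (cases "(s, xs)" rule: advance.cases) (auto simp: idle_def)

lemma conts_well_formed:
  assumes "s \<in> conts p k" "well_formed r b p" "\<forall>p\<in>set k. well_formed r b p"
  shows "\<forall>p\<in>set s. well_formed r b p"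
  using assms by (induction p k arbitrary: s rule: conts.induct) auto

text \<open>Stacks are numbered to give states. The empty stack becomes a state that applies
  \<open>ok\<close> to the scanned symbols and moves to the verdict, which is the one step added to
  \<open>B\<close>.\<close>

lemma compile:
  assumes wf: "well_formed r b P" and r: "r \<ge> 1" and b: "b \<ge> 3"
  obtains M where "turing_machine M"
    "\<And>w B R. triple P (input_tape w # replicate (r - 1) blank_tape) B (\<lambda>ts. ok (map scan ts) \<longleftrightarrow> R) \<Longrightarrow>
      (R \<longrightarrow> accepts_within M w (B + 1)) \<and> (\<not> R \<longrightarrow> rejects_within M w (B + 1))"
proof -
  define S where "S = insert [] (conts P [])"
  have "finite S" by (simp add: S_def finite_conts)
  then obtain N and enc :: "prog list \<Rightarrow> nat" where enc: "enc ` S = {i. i < N}" "inj_on enc S"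
    using finite_imp_inj_to_nat_seg by metis
  define dec where "dec = inv_into S enc"
  have dec_enc: "dec (enc k) = k" if "k \<in> S" for k
    using that enc(2) by (simp add: dec_def)
  have dec_in: "dec i \<in> S" if "i < N" for i
    using that enc(1) unfolding dec_def by (auto intro!: inv_into_into)
  have enc_less: "enc k < N" if "k \<in> S" for k using enc(1) that by blast
  have advance_in: "fst (advance k xs) \<in> S" if "k \<in> S" for k xs
    using that conts_advance[of k P "[]" xs] by (auto simp: S_def)
  have S_wf: "\<forall>p\<in>set k. well_formed r b p" if "k \<in> S" for k
    using that conts_well_formed[of k P "[]"] wf by (auto simp: S_def)
  \<comment> \<open>States 0 and 1 are reserved for acceptance and rejection, so every stack code is
    shifted by 2.\<close>
  define \<delta> where "\<delta> = (\<lambda>q xs.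
     if q < 2 then (q, idle xs)
     else if dec (q - 2) = [] then (if ok xs then 0 else 1, idle xs)
     else (enc (fst (advance (dec (q - 2)) xs)) + 2, snd (advance (dec (q - 2)) xs)))"
  define M where "M = \<lparr>num_tapes = r, num_symbols = b, num_states = N + 2,
     start_state = enc [P] + 2, accept_state = 0, reject_state = 1, transition = \<delta>\<rparr>"
  have P_in: "[P] \<in> S" by (simp add: S_def conts_start)
  have Nil_in: "[] \<in> S" by (simp add: S_def)
  have "turing_machine M"
  proof -
    have "fst (\<delta> q xs) < N + 2 \<and> length (snd (\<delta> q xs)) = r \<and> (\<forall>(y, d)\<in>set (snd (\<delta> q xs)). y < b)"
      if q: "q < N + 2" and xs: "length xs = r" "\<forall>x\<in>set xs. x < b" for q xs
    proof -
      have idle: "length (idle xs) = r \<and> (\<forall>(y, d)\<in>set (idle xs). y < b)"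
        using xs by (auto simp: idle_def)
      consider "q < 2" | "q \<ge> 2" "dec (q - 2) = []" | "q \<ge> 2" "dec (q - 2) \<noteq> []" by linarith
      then show ?thesis
      proof cases
        case 3
        then have "dec (q - 2) \<in> S" using q by (intro dec_in) simp
        then show ?thesis
          using 3 enc_less[OF advance_in] advance_well_formed[OF S_wf xs] by (simp add: \<delta>_def)
      qed (use idle q in \<open>simp_all add: \<delta>_def\<close>)
    qed
    then show ?thesis
      using r b enc_less[OF P_in]
      by (auto simp: turing_machine_def M_def case_prod_beta)
  qed
  moreover have "(R \<longrightarrow> accepts_within M w (B + 1)) \<and> (\<not> R \<longrightarrow> rejects_within M w (B + 1))"
    if T: "triple P (input_tape w # replicate (r - 1) blank_tape) B (\<lambda>ts. ok (map scan ts) \<longleftrightarrow> R)" for w B R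
  proof -
    have step_run: "step M (enc k + 2, ts) = (enc (fst (run_step (k, ts))) + 2, snd (run_step (k, ts)))"
      if "k \<in> S" "k \<noteq> []" for k ts
      using that by (simp add: step_def halted_def M_def \<delta>_def dec_enc case_prod_beta)
    \<comment> \<open>\<open>run_step\<close> idles on the empty stack, whereas the machine leaves
      it for the verdict. The simulation is therefore followed only until that stack is reached,
      after some \<open>t' \<le> t\<close> steps.\<close>
    have sim: "\<exists>t'\<le>t. (step M ^^ t') (enc k + 2, ts) = (enc [] + 2, ts')"
      if "k \<in> S" "(run_step ^^ t) (k, ts) = ([], ts')" for k t ts ts'
      using that
    proof (induction t arbitrary: k ts)
      case (Suc t)
      show ?case
      proof (cases "k = []")
        case True
        have "(run_step ^^ n) ([], ts) = ([], ts)" for n by (induction n) auto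
        from this[of "Suc t"] have "ts' = ts" using Suc.prems(2) True by simp
        then show ?thesis using True by (intro exI[of _ 0]) simp
      next
        case False
        obtain k1 ts1 where 1: "run_step (k, ts) = (k1, ts1)" by (cases "run_step (k, ts)")
        have "k1 \<in> S" using advance_in[OF Suc.prems(1), of "map scan ts"] 1 by (simp add: case_prod_beta)
        moreover have "(run_step ^^ t) (k1, ts1) = ([], ts')"
          using Suc.prems(2) 1 by (simp add: funpow_Suc_right del: funpow.simps run_step.simps)
        ultimately obtain t' where t': "t' \<le> t" "(step M ^^ t') (enc k1 + 2, ts1) = (enc [] + 2, ts')"
          using Suc.IH by blast
        have "(step M ^^ Suc t') (enc k + 2, ts) = (enc [] + 2, ts')"
          using step_run[OF Suc.prems(1) False, of ts] 1 t'(2)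
          by (simp add: funpow_Suc_right del: funpow.simps run_step.simps)
        then show ?thesis using t'(1) by (intro exI[of _ "Suc t'"]) simp
      qed
    qed simp
    obtain t ts' where "t \<le> B"
      and run: "(run_step ^^ t) ([P], input_tape w # replicate (r - 1) blank_tape) = ([], ts')"
      and ok: "ok (map scan ts') \<longleftrightarrow> R"
      using T unfolding triple_def by blast
    then obtain t' where t': "t' \<le> B"
      "(step M ^^ t') (enc [P] + 2, input_tape w # replicate (r - 1) blank_tape) = (enc [] + 2, ts')"
      using sim[OF P_in run] by (meson le_trans)
    have init: "initial_config M w = (enc [P] + 2, input_tape w # replicate (r - 1) blank_tape)"
      by (simp add: initial_config_def M_def)
    let ?q = "if R then 0 else 1 :: nat"
    have last: "step M (enc [] + 2, ts') = (?q, ts')"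
      using ok by (simp add: step_def halted_def M_def \<delta>_def dec_enc[OF Nil_in])
    \<comment> \<open>Halted configurations are fixed by \<open>step\<close>, so the remaining
      \<open>B - t'\<close> steps can be padded to reach exactly \<open>B + 1\<close>.\<close>
    have stay: "(step M ^^ n) (?q, ts') = (?q, ts')" for n
      by (induction n) (auto simp: step_def halted_def M_def)
    have "(step M ^^ 1) (enc [] + 2, ts') = (?q, ts')" using last by simp
    from funpow_trans[OF funpow_trans[OF t'(2) this] stay[of "B - t'"]]
    have "(step M ^^ (B + 1)) (initial_config M w) = (?q, ts')"
      using t'(1) by (simp only: init) (simp del: funpow.simps)
    then show ?thesis by (simp add: accepts_within_def rejects_within_def M_def)
  qed
  ultimately show thesis using that by blast
qed

section \<open>The stability test\<close>

text \<open>
  The machine has eight tapes: the input, the vertex marks, the visited rows, and five one-cell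
  flags. The heads on the second and third tape always share one position \<open>j\<close>. Vertex marks are
  1 (available), 2 (in the current clique), 3 (removed), 4 (the vertex \<open>v\<close> under test); the blank 0
  delimits the vertices. The flags say whether the current vertex misses a clique
  member (0), whether it misses \<open>v\<close> (1), whether the clique is nonempty (2), whether some clique member
  misses \<open>v\<close> (3), and the verdict (4; 1 = stable, 2 = not stable). On the list of all scanned symbols,
  flag \<open>k\<close> has index \<open>k + 3\<close>.
\<close>

definition flag_tape :: "nat \<Rightarrow> tape" where
  "flag_tape x = (\<lambda>i. if i = 0 then x else 0, 0)"

definition conf :: "(int \<Rightarrow> nat) \<Rightarrow> int \<Rightarrow> int \<Rightarrow> (int \<Rightarrow> nat) \<Rightarrow> (int \<Rightarrow> nat) \<Rightarrow> nat list \<Rightarrow> tape list" where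
  "conf inp p j m c fl = (inp, p) # (m, j) # (c, j) # map flag_tape fl"

lemma scan_conf [simp]: "map scan (conf inp p j m c fl) = inp p # m j # c j # fl"
  by (induction fl) (auto simp: conf_def scan_def flag_tape_def)

text \<open>The input symbol is written back unchanged, one direction \<open>dj\<close> drives both
  position tapes, and flag heads stay put. The shape \<open>conf\<close> is thus preserved by
  construction.\<close>

definition assign ::
  "(nat \<Rightarrow> nat \<Rightarrow> nat \<Rightarrow> nat list \<Rightarrow> nat \<times> nat \<times> nat list) \<Rightarrow> move \<Rightarrow> move \<Rightarrow> prog" where
  "assign g dp dj = Do (\<lambda>xs. case g (xs ! 0) (xs ! 1) (xs ! 2) (drop 3 xs) of
     (m, c, fl) \<Rightarrow> (xs ! 0, dp) # (m, dj) # (c, dj) # idle fl)"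

lemma triple_assign:
  assumes "g (inp p) (m j) (c j) fl = (x, y, fl')" "length fl' = length fl"
    and "ts' = conf inp (p + offset dp) (j + offset dj) (m(j := x)) (c(j := y)) fl'"
  shows "triple (assign g dp dj) (conf inp p j m c fl) 1 (\<lambda>ts. ts = ts')"
proof -
  have "map2 act (idle fl') (map flag_tape fl) = map flag_tape fl'"
    using assms(2)
    by (induction fl' fl rule: list_induct2) (auto simp: idle_def act_def flag_tape_def fun_eq_iff)
  then show ?thesis
    unfolding assign_def using assms(1,3)
    by (intro triple_Do) (simp add: conf_def act_def scan_def numeral_eq_Suc, simp add: flag_tape_def comp_def)
qed

abbreviation move :: "move \<Rightarrow> move \<Rightarrow> prog" where
  "move \<equiv> assign (\<lambda>i m c fl. (m, c, fl))"

lemma triple_move: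
  assumes "ts' = conf inp (p + offset dp) (j + offset dj) m c fl"
  shows "triple (move dp dj) (conf inp p j m c fl) 1 (\<lambda>ts. ts = ts')"
  using assms by (intro triple_assign) auto

lemma triple_Seq':
  assumes "triple p ts B (\<lambda>ts'. ts' = u)" "triple q u C Q" "B + C + 1 \<le> D"
  shows "triple (Seq p q) ts D Q"
  using triple_Seq[OF assms(1)] assms(2,3) by (blast intro: triple_conseq)

text \<open>For loops whose course is known exactly: \<open>st k\<close> is the whole configuration
  after \<open>k\<close> rounds, and \<open>N - k\<close> is the variant.\<close>

lemma triple_for:
  assumes "\<And>k. k < N \<Longrightarrow> c (map scan (st k))" "\<not> c (map scan (st N))"
    and "\<And>k. k < N \<Longrightarrow> triple p (st k) B (\<lambda>ts. ts = st (Suc k))"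
    and "ts = st 0" "ts' = st N" "(N + 1) * (B + 1) \<le> C"
  shows "triple (Loop c p) ts C (\<lambda>ts. ts = ts')"
proof (rule triple_conseq[OF triple_Loop[where n = N and I = "\<lambda>n ts. n \<le> N \<and> ts = st (N - n)" and B = B]])
  show "ts = st N" if "n \<le> N \<and> ts = st (N - n)" "\<not> c (map scan ts)" for n ts
    using that assms(1)[of "N - n"] by (cases "n = 0") auto
  show "triple p ts B (\<lambda>ts'. \<exists>m<n. m \<le> N \<and> ts' = st (N - m))"
    if "n \<le> N \<and> ts = st (N - n)" "c (map scan ts)" for n ts
  proof -
    have "n \<noteq> 0" using that assms(2) by (cases "n = 0") auto
    then have n: "N - n < N" "Suc (N - n) = N - (n - 1)" "n - 1 < n" "n - 1 \<le> N" using that by auto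
    have "triple p ts B (\<lambda>ts. ts = st (N - (n - 1)))" using assms(3)[OF n(1)] n(2) that(1) by simp
    then show ?thesis using n(3,4) by (elim triple_conseq) blast+
  qed
qed (use assms in auto)

section \<open>Subroutines of the machine\<close>

definition rewind :: prog where
  "rewind = Seq (move Stay Move_Left)
     (Seq (Loop (\<lambda>xs. xs ! 1 \<noteq> 0) (move Stay Move_Left)) (move Stay Move_Right))"

text \<open>The nonblank marks act as a ruler for one row, so the input head ends at the start of
  the next one. Input symbol 1 is the bit 0, that is, a non-edge.\<close>

definition scan_row :: prog where
  "scan_row = Loop (\<lambda>xs. xs ! 1 \<noteq> 0)
     (assign (\<lambda>i m c fl. (m, c,
        fl[0 := if m = 2 \<and> i = 1 then 1 else fl ! 0, 1 := if m = 4 \<and> i = 1 then 1 else fl ! 1]))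
      Move_Right Move_Right)"

text \<open>The third tape remembers which vertex the row belongs to: it is the first cell there
  that is still blank. Since \<open>v\<close> carries mark 4, it is never chosen for the
  clique.\<close>

definition row :: prog where
  "row = Seq (assign (\<lambda>i m c fl. (m, c, fl[0 := 0, 1 := 0])) Stay Stay)
     (Seq scan_row
     (Seq rewind
     (Seq (Loop (\<lambda>xs. xs ! 2 \<noteq> 0) (move Stay Move_Right))
     (Seq (assign (\<lambda>i m c fl. if m = 1 \<and> fl ! 0 = 0
             then (2, 1, fl[2 := 1, 3 := if fl ! 1 = 1 then 1 else fl ! 3]) else (m, 1, fl)) Stay Stay)
       rewind))))"

text \<open>Brings the input head from behind the matrix back to its first entry: left to the blank
  at -1, then right over the unary prefix and the separator.\<close>

definition home :: prog where
  "home = Seq (move Move_Left Stay)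
     (Seq (Loop (\<lambda>xs. xs ! 0 \<noteq> 0) (move Move_Left Stay))
     (Seq (move Move_Right Stay)
     (Seq (Loop (\<lambda>xs. xs ! 0 = 2) (move Move_Right Stay)) (move Move_Right Stay))))"

definition sweep :: "(nat \<Rightarrow> nat) \<Rightarrow> prog" where
  "sweep h = Seq (Loop (\<lambda>xs. xs ! 1 \<noteq> 0) (assign (\<lambda>i m c fl. (h m, 0, fl)) Stay Move_Right)) rewind"

text \<open>Removed and clique vertices become available again, and the mark 4 moves one cell to the
  right. A blank there means that the last vertex has passed, so the verdict is positive.\<close>

definition next_vertex :: prog where
  "next_vertex = Seq (sweep (\<lambda>x. if x = 4 then 4 else 1))
     (Seq (Loop (\<lambda>xs. xs ! 1 \<noteq> 4) (move Stay Move_Right))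
     (Seq (assign (\<lambda>i m c fl. (1, c, fl)) Stay Move_Right)
     (Cond (\<lambda>xs. xs ! 1 = 0)
        (assign (\<lambda>i m c fl. (m, c, fl[4 := 1])) Stay Stay)
        (Seq (assign (\<lambda>i m c fl. (4, c, fl)) Stay Stay) rewind))))"

definition pass :: prog where
  "pass = Seq (assign (\<lambda>i m c fl. (m, c, fl[2 := 0, 3 := 0])) Stay Stay)
     (Seq (Loop (\<lambda>xs. xs ! 0 \<noteq> 0) row)
     (Seq home
     (Cond (\<lambda>xs. xs ! 5 = 0)
        (assign (\<lambda>i m c fl. (m, c, fl[4 := 2])) Stay Stay)
        (Cond (\<lambda>xs. xs ! 6 = 1) (sweep (\<lambda>x. if x = 2 then 3 else x)) next_vertex))))"

definition main :: prog where
  "main = Seq (Loop (\<lambda>xs. xs ! 0 = 2) (assign (\<lambda>i m c fl. (1, c, fl)) Move_Right Move_Right))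
     (Seq (move Move_Right Stay)
     (Seq rewind
     (Seq (assign (\<lambda>i m c fl. (4, c, fl)) Stay Stay)
       (Loop (\<lambda>xs. xs ! 7 = 0) pass))))"

lemma well_formed_assign:
  assumes "\<And>i m c fl m' c' fl'. g i m c fl = (m', c', fl') \<Longrightarrow> length fl = 5 \<Longrightarrow>
      \<forall>x\<in>set (i # m # c # fl). x < 5 \<Longrightarrow> m' < 5 \<and> c' < 5 \<and> length fl' = 5 \<and> (\<forall>x\<in>set fl'. x < 5)"
  shows "well_formed 8 5 (assign g dp dj)"
  unfolding assign_def well_formed.simps
proof (intro allI impI, elim conjE)
  fix xs :: "nat list" assume xs: "length xs = 8" "\<forall>x\<in>set xs. x < 5"
  obtain m' c' fl' where g: "g (xs ! 0) (xs ! 1) (xs ! 2) (drop 3 xs) = (m', c', fl')"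
    by (cases "g (xs ! 0) (xs ! 1) (xs ! 2) (drop 3 xs)")
  have "\<forall>x\<in>set (xs ! 0 # xs ! 1 # xs ! 2 # drop 3 xs). x < 5"
    using xs in_set_dropD[of _ 3 xs] by auto
  from assms[OF g _ this] xs show
    "length (case g (xs ! 0) (xs ! 1) (xs ! 2) (drop 3 xs) of
        (m, c, fl) \<Rightarrow> (xs ! 0, dp) # (m, dj) # (c, dj) # idle fl) = 8 \<and>
      (\<forall>(y, d)\<in>set (case g (xs ! 0) (xs ! 1) (xs ! 2) (drop 3 xs) of
        (m, c, fl) \<Rightarrow> (xs ! 0, dp) # (m, dj) # (c, dj) # idle fl). y < 5)"
    unfolding g by (auto simp: idle_def)
qed

lemma list_update_bounded:
  "\<forall>x\<in>set xs. x < b \<Longrightarrow> y < b \<Longrightarrow> x \<in> set (xs[i := y]) \<Longrightarrow> x < (b :: nat)"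
  using set_update_subset_insert[of xs i y] by blast

text \<open>Five symbols suffice because the largest mark is 4.\<close>

lemma well_formed_main: "well_formed 8 5 main"
  unfolding main_def pass_def next_vertex_def sweep_def row_def scan_row_def home_def rewind_def
    well_formed.simps
  by (intro conjI well_formed_assign)
     (auto split: if_splits elim!: list_update_bounded[rotated 2])

text \<open>Separates the analysis of the machine from the decoding of graphs. Vertices are integers
  so that they are literally head positions.\<close>

locale matrix_input =
  fixes n :: nat and inp :: "int \<Rightarrow> nat" and E :: "int set set"
  assumes n_pos: "n \<ge> 1"
    and inp_content: "\<And>i. inp i \<noteq> 0 \<longleftrightarrow> 0 \<le> i \<and> i < int n + 1 + int n * int n"
    and inp_unary: "\<And>i. 0 \<le> i \<Longrightarrow> i < int n \<Longrightarrow> inp i = 2"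
    and inp_separator: "inp (int n) = 1"
    and inp_matrix: "\<And>i j. 0 \<le> i \<Longrightarrow> i < int n \<Longrightarrow> 0 \<le> j \<Longrightarrow> j < int n \<Longrightarrow>
      inp (int n + 1 + i * int n + j) = (if {i, j} \<in> E then 2 else 1)"
begin

section \<open>Correctness and running time of the subroutines\<close>

abbreviation V :: "int set" where "V \<equiv> {0..<int n}"

abbreviation supported :: "(int \<Rightarrow> nat) \<Rightarrow> bool" where
  "supported m \<equiv> \<forall>i. m i \<noteq> 0 \<longleftrightarrow> i \<in> V"

text \<open>The case \<open>j = int n\<close> is the usual one: the head stands on the blank behind
  the marks. This is why \<open>rewind\<close> steps left before it first tests for a blank.\<close>

lemma triple_rewind:
  assumes m: "supported m" and j: "0 \<le> j" "j \<le> int n"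
  shows "triple rewind (conf inp p j m c fl) (2 * n + 6) (\<lambda>ts. ts = conf inp p 0 m c fl)"
proof -
  have loop: "triple (Loop (\<lambda>xs. xs ! 1 \<noteq> 0) (move Stay Move_Left)) (conf inp p (j - 1) m c fl)
     (2 * n + 2) (\<lambda>ts. ts = conf inp p (- 1) m c fl)"
  proof (rule triple_for[where N = "nat j" and st = "\<lambda>k. conf inp p (j - 1 - int k) m c fl" and B = 1])
    show "triple (move Stay Move_Left) (conf inp p (j - 1 - int k) m c fl) 1
        (\<lambda>ts. ts = conf inp p (j - 1 - int (Suc k)) m c fl)" for k
      by (rule triple_move) (simp add: algebra_simps)
  qed (use m j in auto)
  show ?thesis unfolding rewind_def
    by (rule triple_Seq'[OF triple_move triple_Seq'[OF loop triple_move]]) auto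
qed

lemma triple_scan_row:
  assumes m: "supported m"
  shows "triple scan_row (conf inp p 0 m c (0 # 0 # fl)) (2 * n + 2)
     (\<lambda>ts. ts = conf inp (p + int n) (int n) m c
       ((if \<exists>x\<in>V. m x = 2 \<and> inp (p + x) = 1 then 1 else 0) #
        (if \<exists>x\<in>V. m x = 4 \<and> inp (p + x) = 1 then 1 else 0) # fl))"
proof -
  \<comment> \<open>The flag after \<open>k\<close> columns: whether some vertex with mark
    \<open>y\<close> among them is a non-neighbour. Both flags are instances, with \<open>y\<close>
    being 2 or 4.\<close>
  define b :: "nat \<Rightarrow> nat \<Rightarrow> nat"
    where "b y k = (if \<exists>x\<in>{0..<int k}. m x = y \<and> inp (p + x) = 1 then 1 else 0)" for y k
  have b_Suc: "b y (Suc k) = (if m (int k) = y \<and> inp (p + int k) = 1 then 1 else b y k)" for y k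
  proof -
    have "{0..<int (Suc k)} = insert (int k) {0..<int k}" by auto
    then show ?thesis unfolding b_def by (simp only:) auto
  qed
  show ?thesis unfolding scan_row_def
  proof (rule triple_for[where N = n and B = 1 and
        st = "\<lambda>k. conf inp (p + int k) (int k) m c (b 2 k # b 4 k # fl)"])
    fix k
    let ?g = "\<lambda>i m c fl. (m, c, fl[0 := if m = 2 \<and> i = 1 then 1 else fl ! 0,
      1 := if m = 4 \<and> i = 1 then 1 else fl ! 1])"
    show "triple (assign ?g Move_Right Move_Right) (conf inp (p + int k) (int k) m c (b 2 k # b 4 k # fl)) 1
      (\<lambda>ts. ts = conf inp (p + int (Suc k)) (int (Suc k)) m c (b 2 (Suc k) # b 4 (Suc k) # fl))"
      by (rule triple_assign) (auto simp: b_Suc algebra_simps fun_upd_idem)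
  qed (use m in \<open>auto simp: b_def\<close>)
qed

definition visited :: "int \<Rightarrow> int \<Rightarrow> nat" where
  "visited u i = (if 0 \<le> i \<and> i < u then 1 else 0)"

text \<open>The first two flags are scratch values that every row resets, so their final contents
  are left existential.\<close>

lemma triple_row:
  assumes m: "supported m" and u: "u \<in> V"
  defines "sel \<equiv> m u = 1 \<and> (\<forall>x. m x = 2 \<longrightarrow> {u, x} \<in> E)"
  shows "triple row (conf inp (int n + 1 + u * int n) 0 m (visited u) [f, vf, ne, vb, s]) (8 * n + 30)
    (\<lambda>ts. \<exists>f' vf'. ts = conf inp (int n + 1 + (u + 1) * int n) 0 (if sel then m(u := 2) else m)
      (visited (u + 1)) [f', vf', if sel then 1 else ne,
        if sel \<and> (\<exists>x. m x = 4 \<and> {u, x} \<notin> E) then 1 else vb, s])"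
proof -
  let ?p = "int n + 1 + u * int n"
  let ?b = "\<lambda>y. if \<exists>x\<in>V. m x = y \<and> inp (?p + x) = 1 then 1 else 0 :: nat"
  define b2 b4 where "b2 = ?b 2" and "b4 = ?b 4"
  have b: "?b y = (if \<exists>x. m x = y \<and> {u, x} \<notin> E then 1 else 0)" if "y \<noteq> 0" for y
    using m that u inp_matrix[of u] by (auto split: if_splits)
  have scan: "triple scan_row (conf inp ?p 0 m (visited u) [0, 0, ne, vb, s]) (2 * n + 2)
    (\<lambda>ts. ts = conf inp (?p + int n) (int n) m (visited u) [b2, b4, ne, vb, s])"
    unfolding b2_def b4_def by (rule triple_scan_row[OF m])
  let ?m = "if sel then m(u := 2) else m"
  let ?fl = "[b2, b4, if sel then 1 else ne, if sel \<and> (\<exists>x. m x = 4 \<and> {u, x} \<notin> E) then 1 else vb, s]"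
  have p': "?p + int n = int n + 1 + (u + 1) * int n" by (simp add: algebra_simps)
  have m': "supported ?m" using m u by auto
  have goto: "triple (Loop (\<lambda>xs. xs ! 2 \<noteq> 0) (move Stay Move_Right))
    (conf inp (?p + int n) 0 m (visited u) fl) (2 * n + 2) (\<lambda>ts. ts = conf inp (?p + int n) u m (visited u) fl)" for fl
  proof (rule triple_for[where N = "nat u" and st = "\<lambda>k. conf inp (?p + int n) (int k) m (visited u) fl" and B = 1])
    show "triple (move Stay Move_Right) (conf inp (?p + int n) (int k) m (visited u) fl) 1
      (\<lambda>ts. ts = conf inp (?p + int n) (int (Suc k)) m (visited u) fl)" for k
      by (rule triple_move) (simp add: add.commute)
  qed (use u in \<open>auto simp: visited_def\<close>)
  have sel: "sel \<longleftrightarrow> m u = 1 \<and> b2 = 0"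
    unfolding sel_def b2_def using b[of 2] by auto
  have vis: "(visited u)(u := 1) = visited (u + 1)"
    using u by (auto simp: visited_def fun_eq_iff)
  let ?g = "\<lambda>i m c fl. if m = 1 \<and> fl ! 0 = 0
             then (2, 1, fl[2 := 1, 3 := if fl ! 1 = 1 then 1 else fl ! 3]) else (m, 1, fl)"
  have choose: "triple (assign ?g Stay Stay) (conf inp (?p + int n) u m (visited u) [b2, b4, ne, vb, s]) 1
    (\<lambda>ts. ts = conf inp (?p + int n) u ?m (visited (u + 1)) ?fl)"
  proof (rule triple_assign)
    show "?g (inp (?p + int n)) (m u) (visited u u) [b2, b4, ne, vb, s] =
      (if sel then 2 else m u, 1, ?fl)"
      unfolding sel b4_def using b[of 4] by auto
  qed (use vis in \<open>auto simp: fun_upd_idem\<close>)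
  have "triple row (conf inp ?p 0 m (visited u) [f, vf, ne, vb, s]) (8 * n + 30)
    (\<lambda>ts. ts = conf inp (?p + int n) 0 ?m (visited (u + 1)) ?fl)"
    unfolding row_def
  proof (rule triple_Seq'[OF triple_assign triple_Seq'[OF scan
        triple_Seq'[OF triple_rewind[OF m] triple_Seq'[OF goto triple_Seq'[OF choose triple_rewind[OF m']]]]]])
  qed (use u in auto)
  then show ?thesis unfolding p' by (elim triple_conseq) auto
qed

abbreviation mark :: "int set \<Rightarrow> (int \<Rightarrow> nat) \<Rightarrow> int \<Rightarrow> nat" where
  "mark K m i \<equiv> if i \<in> K then 2 else m i"

text \<open>Greedy choice in increasing order: after \<open>u\<close> rows, \<open>K\<close> is a
  maximal clique among the available vertices below \<open>u\<close>. A rejected vertex keeps its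
  non-neighbour in \<open>K\<close>, since \<open>K\<close> only grows.\<close>

lemma triple_rows:
  assumes m: "supported m" and no2: "\<And>x. m x \<noteq> 2"
  shows "triple (Loop (\<lambda>xs. xs ! 0 \<noteq> 0) row) (conf inp (int n + 1) 0 m (visited 0) [f, vf, 0, 0, s])
    ((n + 1) * (8 * n + 31))
    (\<lambda>ts. \<exists>f' vf' K. maximal_clique E {x. m x = 1} K \<and>
      ts = conf inp (int n + 1 + int n * int n) 0 (mark K m) (visited (int n)) [f', vf', if K = {} then 0 else 1,
        if \<exists>k\<in>K. \<exists>x. m x = 4 \<and> {k, x} \<notin> E then 1 else 0, s])"
proof -
  let ?A = "{x. m x = 1}"
  define st where "st u f vf K = conf inp (int n + 1 + int u * int n) 0 (mark K m) (visited (int u))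
    [f, vf, if K = {} then 0 else 1, if \<exists>k\<in>K. \<exists>x. m x = 4 \<and> {k, x} \<notin> E then 1 else 0, s]" for u f vf K
  let ?I = "\<lambda>k ts. \<exists>u f vf K. u \<le> n \<and> k = n - u \<and>
      maximal_clique E (?A \<inter> {..<int u}) K \<and> ts = st u f vf K"
  have A: "?A \<subseteq> V" using m by (metis (mono_tags, lifting) mem_Collect_eq one_neq_zero subsetI)
  \<comment> \<open>At a row boundary the input head sees a blank exactly when all \<open>n\<close>
    rows are consumed, so the loop test counts rows.\<close>
  have end_iff: "inp (int n + 1 + int u * int n) \<noteq> 0 \<longleftrightarrow> u < n" if "u \<le> n" for u
  proof -
    have "int u * int n < int n * int n \<longleftrightarrow> u < n"
      using n_pos by (simp add: mult_less_cancel_right)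
    then show ?thesis unfolding inp_content by (smt (verit) of_nat_0_le_iff mult_nonneg_nonneg)
  qed
  show ?thesis
  proof (rule triple_conseq[OF triple_Loop[where I = ?I and n = n and B = "8 * n + 30"]])
    show "?I n (conf inp (int n + 1) 0 m (visited 0) [f, vf, 0, 0, s])"
    proof (intro exI conjI)
      have "?A \<inter> {..<int 0} = {}" using A by auto
      then show "maximal_clique E (?A \<inter> {..<int 0}) {}" by (simp add: maximal_clique_def clique_def)
    qed (auto simp: st_def)
    show "\<exists>f' vf' K. maximal_clique E ?A K \<and>
        ts = conf inp (int n + 1 + int n * int n) 0 (mark K m) (visited (int n)) [f', vf', if K = {} then 0 else 1,
          if \<exists>k\<in>K. \<exists>x. m x = 4 \<and> {k, x} \<notin> E then 1 else 0, s]"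
      if I: "?I k ts" and c: "\<not> map scan ts ! 0 \<noteq> 0" for k ts
    proof -
      obtain u f vf K where u: "u \<le> n" "maximal_clique E (?A \<inter> {..<int u}) K" and ts: "ts = st u f vf K"
        using I by blast
      have "u = n" using c end_iff[OF u(1)] u(1) by (simp add: ts st_def)
      moreover have "?A \<inter> {..<int n} = ?A" using A by auto
      ultimately have "maximal_clique E ?A K" "ts = st n f vf K" using u(2) ts by simp_all
      then show ?thesis unfolding st_def by blast
    qed
    show "triple row ts (8 * n + 30) (\<lambda>ts'. \<exists>k'<k. ?I k' ts')"
      if I: "?I k ts" and c: "map scan ts ! 0 \<noteq> 0" for k ts
    proof -
      obtain u f vf K where u: "u \<le> n" "k = n - u" and K: "maximal_clique E (?A \<inter> {..<int u}) K"
        and ts: "ts = st u f vf K"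
        using I by blast
      have "u < n" using c end_iff[OF u(1)] by (simp add: ts st_def)
      have KA: "K \<subseteq> ?A \<inter> {..<int u}" using K by (simp add: maximal_clique_def)
      have sup: "supported (mark K m)" using m KA A by auto
      define sel where "sel \<longleftrightarrow> m (int u) = 1 \<and> (\<forall>x\<in>K. {int u, x} \<in> E)"
      have sel_iff: "mark K m (int u) = 1 \<and> (\<forall>x. mark K m x = 2 \<longrightarrow> {int u, x} \<in> E) \<longleftrightarrow> sel"
        using KA no2 unfolding sel_def by auto
      define K' where "K' = (if sel then insert (int u) K else K)"
      have split: "?A \<inter> {..<int (Suc u)} = (if m (int u) = 1 then insert (int u) (?A \<inter> {..<int u}) else ?A \<inter> {..<int u})"
        by (auto simp: less_le)
      have K'_max: "maximal_clique E (?A \<inter> {..<int (Suc u)}) K'"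
      proof (cases sel)
        case True
        with K show ?thesis unfolding split K'_def maximal_clique_def clique_def sel_def
          by (auto simp: insert_commute)
      next
        case False
        with K show ?thesis unfolding split K'_def maximal_clique_def sel_def
          by auto
      qed
      have m': "(if sel then (mark K m)(int u := 2) else mark K m) = mark K' m"
        by (auto simp: K'_def fun_eq_iff)
      have m4: "mark K m x = 4 \<longleftrightarrow> m x = 4" for x using KA by auto
      have p: "int n + 1 + (int u + 1) * int n = int n + 1 + int (Suc u) * int n"
        "visited (int u + 1) = visited (int (Suc u))" by (simp_all add: add.commute)
      have fl: "[if sel then 1 else if K = {} then 0 else 1,
          if sel \<and> (\<exists>x. m x = 4 \<and> {int u, x} \<notin> E) then 1
          else if \<exists>k\<in>K. \<exists>x. m x = 4 \<and> {k, x} \<notin> E then 1 else 0, s]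
        = [if K' = {} then 0 else 1, if \<exists>k\<in>K'. \<exists>x. m x = 4 \<and> {k, x} \<notin> E then 1 else (0 :: nat), s]"
        unfolding K'_def by auto
      have uV: "int u \<in> V" using \<open>u < n\<close> by simp
      from triple_row[OF sup uV, unfolded sel_iff m' m4 p]
      have "triple row ts (8 * n + 30) (\<lambda>ts'. \<exists>f' vf'. ts' = st (Suc u) f' vf' K')"
        unfolding ts st_def fl[symmetric] .
      then show ?thesis
      proof (rule triple_conseq)
        fix ts' assume "\<exists>f' vf'. ts' = st (Suc u) f' vf' K'"
        then obtain f' vf' where "ts' = st (Suc u) f' vf' K'" by blast
        moreover have "Suc u \<le> n" "n - Suc u < k" using \<open>u < n\<close> u(2) by auto
        ultimately show "\<exists>k'<k. ?I k' ts'" using K'_max by blast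
      qed simp
    qed
  qed auto
qed

lemma triple_home:
  "triple home (conf inp (int n + 1 + int n * int n) 0 m c fl) (2 * (n * n) + 4 * n + 20)
     (\<lambda>ts. ts = conf inp (int n + 1) 0 m c fl)"
proof -
  have left: "triple (Loop (\<lambda>xs. xs ! 0 \<noteq> 0) (move Move_Left Stay))
    (conf inp (int n + int n * int n) 0 m c fl) (2 * (n * n) + 2 * n + 4) (\<lambda>ts. ts = conf inp (- 1) 0 m c fl)"
  proof (rule triple_for[where N = "n + n * n + 1" and B = 1 and
        st = "\<lambda>k. conf inp (int n + int n * int n - int k) 0 m c fl"])
    show "triple (move Move_Left Stay) (conf inp (int n + int n * int n - int k) 0 m c fl) 1
      (\<lambda>ts. ts = conf inp (int n + int n * int n - int (Suc k)) 0 m c fl)" for k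
      by (rule triple_move) (simp add: algebra_simps)
    show "map scan (conf inp (int n + int n * int n - int k) 0 m c fl) ! 0 \<noteq> 0"
      if "k < n + n * n + 1" for k
    proof -
      have "int k < int (n + n * n + 1)" using that by (simp only: of_nat_less_iff)
      then have "inp (int n + int n * int n - int k) \<noteq> 0" unfolding inp_content by simp
      then show ?thesis by simp
    qed
  qed (use inp_content[of "- 1"] in auto)
  have right: "triple (Loop (\<lambda>xs. xs ! 0 = 2) (move Move_Right Stay))
    (conf inp 0 0 m c fl) (2 * n + 2) (\<lambda>ts. ts = conf inp (int n) 0 m c fl)"
  proof (rule triple_for[where N = n and B = 1 and st = "\<lambda>k. conf inp (int k) 0 m c fl"])
    show "triple (move Move_Right Stay) (conf inp (int k) 0 m c fl) 1
      (\<lambda>ts. ts = conf inp (int (Suc k)) 0 m c fl)" for k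
      by (rule triple_move) (simp add: add.commute)
  qed (auto simp: inp_unary inp_separator)
  show ?thesis unfolding home_def
    by (rule triple_Seq'[OF triple_move triple_Seq'[OF left triple_Seq'[OF triple_move
          triple_Seq'[OF right triple_move]]]]) auto
qed

text \<open>\<open>h\<close> must not produce blanks, since the final \<open>rewind\<close> relies
  on the marks still delimiting the vertices.\<close>

lemma triple_sweep:
  assumes m: "supported m" and h: "\<And>x. x \<noteq> 0 \<Longrightarrow> h x \<noteq> 0"
    and m': "m' = (\<lambda>i. if i \<in> V then h (m i) else 0)"
  shows "triple (sweep h) (conf inp p 0 m (visited (int n)) fl) (4 * n + 9)
    (\<lambda>ts. ts = conf inp p 0 m' (visited 0) fl)"
proof -
  define ms where "ms k i = (if 0 \<le> i \<and> i < int k then h (m i) else m i)" for k i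
  \<comment> \<open>The visited marks are erased from the left, so the intermediate contents are an
    upper segment.\<close>
  define cs where "cs k i = (if int k \<le> i \<and> i < int n then 1 else 0 :: nat)" for k i
  have 0: "ms 0 = m" "cs 0 = visited (int n)" by (auto simp: ms_def cs_def visited_def fun_eq_iff)
  have n: "ms n = m'" "cs n = visited 0"
    using m by (auto simp: ms_def cs_def visited_def m' fun_eq_iff)
  have loop: "triple (Loop (\<lambda>xs. xs ! 1 \<noteq> 0) (assign (\<lambda>i m c fl. (h m, 0, fl)) Stay Move_Right))
    (conf inp p 0 m (visited (int n)) fl) (2 * n + 2) (\<lambda>ts. ts = conf inp p (int n) m' (visited 0) fl)"
  proof (rule triple_for[where N = n and B = 1 and st = "\<lambda>k. conf inp p (int k) (ms k) (cs k) fl"])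
    show "triple (assign (\<lambda>i m c fl. (h m, 0, fl)) Stay Move_Right)
      (conf inp p (int k) (ms k) (cs k) fl) 1 (\<lambda>ts. ts = conf inp p (int (Suc k)) (ms (Suc k)) (cs (Suc k)) fl)"
      if "k < n" for k
    proof (rule triple_assign)
      have "ms (Suc k) = (ms k)(int k := h (ms k (int k)))" "cs (Suc k) = (cs k)(int k := 0)"
        using that by (auto simp: ms_def cs_def fun_eq_iff)
      then show "conf inp p (int (Suc k)) (ms (Suc k)) (cs (Suc k)) fl = conf inp (p + offset Stay)
        (int k + offset Move_Right) ((ms k)(int k := h (ms k (int k)))) ((cs k)(int k := 0)) fl"
        by (simp add: add.commute)
    qed auto
    show "map scan (conf inp p (int k) (ms k) (cs k) fl) ! 1 \<noteq> 0" if "k < n" for k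
      using that m by (simp add: ms_def)
    show "\<not> map scan (conf inp p (int n) (ms n) (cs n) fl) ! 1 \<noteq> 0"
      using m by (simp add: ms_def)
  qed (simp_all add: 0 n)
  have "supported m'" using m h by (auto simp: m')
  then show ?thesis unfolding sweep_def
    by (intro triple_Seq'[OF loop triple_rewind]) auto
qed

definition marks :: "int \<Rightarrow> int set \<Rightarrow> int \<Rightarrow> nat" where
  "marks v X i = (if i \<in> V then if i = v then 4 else if i \<in> X then 3 else 1 else 0)"

text \<open>After the last vertex only the verdict flag matters, hence the unspecified marks and
  head position in that case.\<close>

lemma triple_next_vertex:
  assumes m: "supported m" and v: "v \<in> V" "\<And>i. m i = 4 \<longleftrightarrow> i = v"
  shows "triple next_vertex (conf inp p 0 m (visited (int n)) [f, vf, ne, vb, s]) (8 * n + 40)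
    (\<lambda>ts. if v + 1 < int n then ts = conf inp p 0 (marks (v + 1) {}) (visited 0) [f, vf, ne, vb, s]
      else \<exists>j m c. ts = conf inp p j m c [f, vf, ne, vb, 1])"
proof -
  let ?fl = "[f, vf, ne, vb, s]"
  have "triple (sweep (\<lambda>x. if x = 4 then 4 else 1)) (conf inp p 0 m (visited (int n)) ?fl) (4 * n + 9)
    (\<lambda>ts. ts = conf inp p 0 (marks v {}) (visited 0) ?fl)"
    by (rule triple_sweep[OF m]) (auto simp: marks_def v(2) fun_eq_iff)
  note 1 = triple_Seq'[OF this]
  have "triple (Loop (\<lambda>xs. xs ! 1 \<noteq> 4) (move Stay Move_Right)) (conf inp p 0 (marks v {}) (visited 0) ?fl)
    (2 * n + 2) (\<lambda>ts. ts = conf inp p v (marks v {}) (visited 0) ?fl)"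
  proof (rule triple_for[where N = "nat v" and B = 1 and
        st = "\<lambda>k. conf inp p (int k) (marks v {}) (visited 0) ?fl"])
    show "triple (move Stay Move_Right) (conf inp p (int k) (marks v {}) (visited 0) ?fl) 1
      (\<lambda>ts. ts = conf inp p (int (Suc k)) (marks v {}) (visited 0) ?fl)" for k
      by (rule triple_move) (simp add: add.commute)
  qed (use v(1) in \<open>auto simp: marks_def\<close>)
  note 2 = triple_Seq'[OF this]
  let ?m = "(marks v {})(v := 1)"
  have "triple (assign (\<lambda>i m c fl. (1, c, fl)) Stay Move_Right) (conf inp p v (marks v {}) (visited 0) ?fl) 1
    (\<lambda>ts. ts = conf inp p (v + 1) ?m (visited 0) ?fl)"
    by (rule triple_assign) auto
  note 3 = triple_Seq'[OF this]
  show ?thesis unfolding next_vertex_def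
  proof (rule 1[OF 2[OF 3[OF triple_Cond]]])
    show "triple (assign (\<lambda>i m c fl. (m, c, fl[4 := 1])) Stay Stay)
       (conf inp p (v + 1) ?m (visited 0) ?fl) (2 * n + 8)
      (\<lambda>ts. if v + 1 < int n then ts = conf inp p 0 (marks (v + 1) {}) (visited 0) ?fl
        else \<exists>j m c. ts = conf inp p j m c [f, vf, ne, vb, 1])"
      if "map scan (conf inp p (v + 1) ?m (visited 0) ?fl) ! 1 = 0"
    proof (rule triple_conseq[OF triple_assign[OF _ _ refl]])
      have "\<not> v + 1 < int n" using that v by (auto simp: marks_def split: if_splits)
      then show "if v + 1 < int n then ts' = conf inp p 0 (marks (v + 1) {}) (visited 0) ?fl
        else \<exists>j m c. ts' = conf inp p j m c [f, vf, ne, vb, 1]"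
        if "ts' = conf inp (p + offset Stay) (v + 1 + offset Stay) (?m(v + 1 := ?m (v + 1)))
          ((visited 0)(v + 1 := visited 0 (v + 1))) (?fl[4 := 1])" for ts'
        using that by auto
    qed auto
    have "triple (Seq (assign (\<lambda>i m c fl. (4, c, fl)) Stay Stay) rewind)
       (conf inp p (v + 1) ?m (visited 0) ?fl) (2 * n + 8)
      (\<lambda>ts. ts = conf inp p 0 (marks (v + 1) {}) (visited 0) ?fl)" if "v + 1 < int n"
    proof (rule triple_Seq'[OF _ triple_rewind])
      have "marks (v + 1) {} = ?m(v + 1 := 4)"
        using that v(1) by (auto simp: marks_def fun_eq_iff)
      then show "triple (assign (\<lambda>i m c fl. (4, c, fl)) Stay Stay) (conf inp p (v + 1) ?m (visited 0) ?fl) 1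
        (\<lambda>ts. ts = conf inp p (v + 1) (marks (v + 1) {}) (visited 0) ?fl)"
        by (intro triple_assign) auto
    qed (use that v(1) in \<open>auto simp: marks_def\<close>)
    moreover have "v + 1 < int n" if "map scan (conf inp p (v + 1) ?m (visited 0) ?fl) ! 1 \<noteq> 0"
      using that v by (auto simp: marks_def split: if_splits)
    ultimately show "triple (Seq (assign (\<lambda>i m c fl. (4, c, fl)) Stay Stay) rewind)
       (conf inp p (v + 1) ?m (visited 0) ?fl) (2 * n + 8)
      (\<lambda>ts. if v + 1 < int n then ts = conf inp p 0 (marks (v + 1) {}) (visited 0) ?fl
        else \<exists>j m c. ts = conf inp p j m c [f, vf, ne, vb, 1])"
      if "map scan (conf inp p (v + 1) ?m (visited 0) ?fl) ! 1 \<noteq> 0"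
      using that by presburger
  qed auto
qed

section \<open>Invariant and termination of the stability test\<close>

definition stable :: bool where
  "stable \<longleftrightarrow> (\<forall>w\<in>V. alpha_on E (V - {w}) = alpha_on E V)"

text \<open>\<open>X\<close> is the set of vertices removed so far while \<open>v\<close> is being tested. Removing a clique from
  \<open>V\<close> and from \<open>V - {v}\<close> has lowered both independence numbers by the same amount.\<close>

definition progress :: "int \<Rightarrow> int set \<Rightarrow> bool" where
  "progress v X \<longleftrightarrow> v \<in> V \<and> X \<subseteq> V - {v} \<and>
     (\<exists>q. alpha_on E (V - X) + q = alpha_on E V \<and> alpha_on E (V - {v} - X) + q = alpha_on E (V - {v})) \<and>
     (\<forall>w\<in>V. w < v \<longrightarrow> alpha_on E (V - {w}) = alpha_on E V)"

text \<open>A lexicographic measure in one number: vertices still to be tested first, then vertices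
  not yet removed. The weight \<open>n + 1\<close> exceeds any \<open>card X\<close>, so moving to
  the next vertex pays for resetting \<open>X\<close>.\<close>

definition potential :: "int \<Rightarrow> int set \<Rightarrow> nat" where
  "potential v X = (n - nat v) * (n + 1) - card X"

lemma progress_card: "progress v X \<Longrightarrow> card X < n"
proof -
  assume "progress v X"
  then have "X \<subset> V" by (auto simp: progress_def)
  then have "card X < card V" by (intro psubset_card_mono) auto
  then show "card X < n" by simp
qed

text \<open>Positivity guards the truncated subtraction, and it leaves a smaller value for the pass
  that halts.\<close>

lemma potential_vertex:
  assumes "progress v X"
  shows "potential v X > 0" "potential (v + 1) {} < potential v X"
proof -
  have "nat v < n" using assms by (auto simp: progress_def)
  moreover have "nat (v + 1) = Suc (nat v)" using assms by (auto simp: progress_def)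
  moreover obtain d where "n = Suc (nat v + d)" using \<open>nat v < n\<close> less_natE by metis
  ultimately have d: "n - nat v = Suc d" "n - nat (v + 1) = d" by auto
  show "potential v X > 0" "potential (v + 1) {} < potential v X"
    using progress_card[OF assms] unfolding potential_def d by auto
qed

lemma potential_less:
  assumes "progress v Y" "X \<subset> Y"
  shows "potential v Y < potential v X"
proof -
  have "finite Y" using assms(1) finite_subset[of Y V] by (auto simp: progress_def)
  then have "card X < card Y" using assms(2) by (rule psubset_card_mono)
  then show ?thesis using potential_vertex(1)[OF assms(1)] unfolding potential_def by linarith
qed

lemma progress_start: "0 \<in> V \<Longrightarrow> progress 0 {}"
  by (auto simp: progress_def)

context
  assumes meet: "cliques_meet_indeps E V"
begin

lemma remove_clique:
  "W \<subseteq> V \<Longrightarrow> W \<noteq> {} \<Longrightarrow> maximal_clique E W K \<Longrightarrow> alpha_on E W = alpha_on E (W - K) + 1"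
  using alpha_on_remove_clique[OF _ meet] by simp

lemma progress_stuck:
  assumes "progress v X" "V - {v} - X = {}"
  shows "\<not> stable"
proof -
  have VX: "V - X = {v}" "v \<in> V" using assms by (auto simp: progress_def)
  obtain q where "alpha_on E (V - X) + q = alpha_on E V"
    "alpha_on E (V - {v} - X) + q = alpha_on E (V - {v})"
    using assms(1) unfolding progress_def by blast
  then have "alpha_on E (V - {v}) \<noteq> alpha_on E V"
    unfolding VX assms(2) by simp
  then show ?thesis using VX by (auto simp: stable_def)
qed

lemma progress_next_clique:
  assumes p: "progress v X" and K: "maximal_clique E (V - {v} - X) K" "k \<in> K" "{k, v} \<notin> E"
  shows "progress v (X \<union> K)"
proof -
  obtain q where q: "alpha_on E (V - X) + q = alpha_on E V"
    "alpha_on E (V - {v} - X) + q = alpha_on E (V - {v})"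
    using p unfolding progress_def by blast
  have vX: "v \<in> V" "v \<notin> X" using p by (auto simp: progress_def)
  have KW: "K \<subseteq> V - {v} - X" using K by (simp add: maximal_clique_def)
  \<comment> \<open>The only vertex new to the larger subset is \<open>v\<close>, and
    \<open>k\<close> is its non-neighbour.\<close>
  have "\<exists>y\<in>K. {x, y} \<notin> E" if "x \<in> V - X - K" for x
  proof (cases "x = v")
    case True
    then show ?thesis using K(2,3) by (auto simp: insert_commute)
  next
    case False
    then show ?thesis using K(1) that by (auto simp: maximal_clique_def)
  qed
  then have "maximal_clique E (V - X) K"
    using K(1) KW by (auto simp: maximal_clique_def)
  then have "alpha_on E (V - X) = alpha_on E (V - X - K) + 1"
    using vX by (intro remove_clique) auto
  moreover have "alpha_on E (V - {v} - X) = alpha_on E (V - {v} - X - K) + 1"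
    using K KW by (intro remove_clique) auto
  ultimately have "alpha_on E (V - (X \<union> K)) + (q + 1) = alpha_on E V"
    "alpha_on E (V - {v} - (X \<union> K)) + (q + 1) = alpha_on E (V - {v})"
    using q by (simp_all add: Diff_eq Int_assoc)
  moreover have "X \<union> K \<subseteq> V - {v}" using p KW by (auto simp: progress_def)
  ultimately show ?thesis using p unfolding progress_def by blast
qed

lemma progress_vertex_done:
  assumes p: "progress v X" and K: "maximal_clique E (V - {v} - X) K" "K \<noteq> {}" "\<forall>k\<in>K. {k, v} \<in> E"
  shows "alpha_on E (V - {v}) = alpha_on E V"
proof -
  obtain q where q: "alpha_on E (V - X) + q = alpha_on E V"
    "alpha_on E (V - {v} - X) + q = alpha_on E (V - {v})"
    using p unfolding progress_def by blast
  have vX: "v \<in> V" "v \<notin> X" using p by (auto simp: progress_def)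
  have KW: "K \<subseteq> V - {v} - X" using K by (simp add: maximal_clique_def)
  have "maximal_clique E (V - X) (insert v K)"
    using K vX unfolding maximal_clique_def clique_def by (auto simp: insert_commute)
  then have "alpha_on E (V - X) = alpha_on E (V - X - insert v K) + 1"
    using vX by (intro remove_clique) auto
  moreover have "alpha_on E (V - {v} - X) = alpha_on E (V - {v} - X - K) + 1"
    using K KW by (intro remove_clique) auto
  \<comment> \<open>The two cliques leave the same remainder, so equal numbers were reduced by one
    on both sides.\<close>
  moreover have "V - X - insert v K = V - {v} - X - K" by auto
  ultimately show ?thesis using q by simp
qed

lemma progress_next_vertex:
  assumes "progress v X" "alpha_on E (V - {v}) = alpha_on E V"
  shows "v + 1 < int n \<Longrightarrow> progress (v + 1) {}" "\<not> v + 1 < int n \<Longrightarrow> stable"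
proof -
  have *: "alpha_on E (V - {w}) = alpha_on E V" if "w \<in> V" "w < v + 1" for w
    using assms that by (cases "w = v") (auto simp: progress_def)
  then show "v + 1 < int n \<Longrightarrow> progress (v + 1) {}"
    using assms(1) by (auto simp: progress_def)
  show "\<not> v + 1 < int n \<Longrightarrow> stable"
    using * by (auto simp: stable_def)
qed

section \<open>The main loop\<close>

definition halting :: "tape list \<Rightarrow> bool" where
  "halting ts \<longleftrightarrow> (\<exists>p j m c f vf ne vb s. ts = conf inp p j m c [f, vf, ne, vb, s] \<and> s \<noteq> 0 \<and> (s = 1 \<longleftrightarrow> stable))"

lemma haltingI: "s \<noteq> 0 \<Longrightarrow> (s = 1 \<longleftrightarrow> stable) \<Longrightarrow> halting (conf inp p j m c [f, vf, ne, vb, s])"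
  unfolding halting_def by blast

definition testing :: "int \<Rightarrow> int set \<Rightarrow> tape list \<Rightarrow> bool" where
  "testing v X ts \<longleftrightarrow> progress v X \<and>
     (\<exists>f vf ne vb. ts = conf inp (int n + 1) 0 (marks v X) (visited 0) [f, vf, ne, vb, 0])"

text \<open>The three outcomes for the clique match the three branches: empty, some member missing
  \<open>v\<close>, or all members adjacent to \<open>v\<close>. The bound is dominated by the
  quadratic reading of the matrix.\<close>

lemma triple_pass:
  assumes "testing v X ts"
  shows "triple pass ts (10 * (n * n) + 60 * n + 150)
    (\<lambda>ts'. halting ts' \<or> (\<exists>v' X'. testing v' X' ts' \<and> potential v' X' < potential v X))"
proof -
  let ?Q = "\<lambda>ts'. halting ts' \<or> (\<exists>v' X'. testing v' X' ts' \<and> potential v' X' < potential v X)"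
  let ?m = "marks v X"
  obtain f vf ne vb where p: "progress v X" and
    ts: "ts = conf inp (int n + 1) 0 ?m (visited 0) [f, vf, ne, vb, 0]"
    using assms unfolding testing_def by blast
  have vX: "v \<in> V" "X \<subseteq> V - {v}" using p by (auto simp: progress_def)
  have avail: "{x. ?m x = 1} = V - {v} - X" using vX by (auto simp: marks_def)
  have m4: "?m x = 4 \<longleftrightarrow> x = v" for x using vX by (auto simp: marks_def)
  have sup: "supported ?m" by (simp add: marks_def)
  have no2: "?m x \<noteq> 2" for x by (simp add: marks_def)
  let ?decide = "Cond (\<lambda>xs. xs ! 5 = 0) (assign (\<lambda>i m c fl. (m, c, fl[4 := 2])) Stay Stay)
        (Cond (\<lambda>xs. xs ! 6 = 1) (sweep (\<lambda>x. if x = 2 then 3 else x)) next_vertex)"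
  \<comment> \<open>\<open>8 * n + 40\<close> is the cost of \<open>next_vertex\<close>, the dearest
    branch; the two added steps are the nested tests.\<close>
  have decide: "triple ?decide (conf inp (int n + 1) 0 (mark K ?m) (visited (int n))
      [f', vf', if K = {} then 0 else 1, if \<exists>k\<in>K. {k, v} \<notin> E then 1 else 0, 0]) (8 * n + 40 + 1 + 1) ?Q"
    if K: "maximal_clique E (V - {v} - X) K" for K f' vf'
  proof -
    have KW: "K \<subseteq> V - {v} - X" using K by (simp add: maximal_clique_def)
    have sup': "supported (mark K ?m)" using sup KW by auto
    consider "K = {}" | k where "K \<noteq> {}" "k \<in> K" "{k, v} \<notin> E" | "K \<noteq> {}" "\<forall>k\<in>K. {k, v} \<in> E" by blast
    then show ?thesis
    proof cases
      case 1
      then have "V - {v} - X = {}" using maximal_clique_nonempty[OF K] by blast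
      then have ns: "\<not> stable" using progress_stuck[OF p] by blast
      have fl: "(if K = {} then 0 else 1) = (0 :: nat)" "(if \<exists>k\<in>K. {k, v} \<notin> E then 1 else 0) = (0 :: nat)"
        and m: "mark K ?m = ?m"
        using 1 by auto
      have "triple (assign (\<lambda>i m c fl. (m, c, fl[4 := 2])) Stay Stay)
          (conf inp (int n + 1) 0 ?m (visited (int n)) [f', vf', 0, 0, 0]) 1
          (\<lambda>ts. ts = conf inp (int n + 1) 0 ?m (visited (int n)) [f', vf', 0, 0, 2])"
        by (rule triple_assign) auto
      then have "triple (assign (\<lambda>i m c fl. (m, c, fl[4 := 2])) Stay Stay)
          (conf inp (int n + 1) 0 ?m (visited (int n)) [f', vf', 0, 0, 0]) (8 * n + 40 + 1) ?Q"
        by (rule triple_conseq) (use ns in \<open>simp_all add: haltingI\<close>)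
      then show ?thesis unfolding fl m by (intro triple_Cond) auto
    next
      case 2
      have pr: "progress v (X \<union> K)" using progress_next_clique[OF p K 2(2,3)] .
      have "X \<subset> X \<union> K" using 2 KW by blast
      then have pot: "potential v (X \<union> K) < potential v X" using potential_less[OF pr] by blast
      have fl: "(if K = {} then 0 else 1) = (1 :: nat)" "(if \<exists>k\<in>K. {k, v} \<notin> E then 1 else 0) = (1 :: nat)"
        using 2 by auto
      have "triple (sweep (\<lambda>x. if x = 2 then 3 else x))
          (conf inp (int n + 1) 0 (mark K ?m) (visited (int n)) [f', vf', 1, 1, 0]) (4 * n + 9)
          (\<lambda>ts. ts = conf inp (int n + 1) 0 (marks v (X \<union> K)) (visited 0) [f', vf', 1, 1, 0])"
        using KW vX by (intro triple_sweep[OF sup']) (auto simp: marks_def fun_eq_iff)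
      then have "triple (sweep (\<lambda>x. if x = 2 then 3 else x))
          (conf inp (int n + 1) 0 (mark K ?m) (visited (int n)) [f', vf', 1, 1, 0]) (8 * n + 40) ?Q"
      proof (rule triple_conseq)
        fix ts' assume "ts' = conf inp (int n + 1) 0 (marks v (X \<union> K)) (visited 0) [f', vf', 1, 1, 0]"
        then have "testing v (X \<union> K) ts'" using pr unfolding testing_def by blast
        with pot show "?Q ts'" by blast
      qed simp
      then show ?thesis unfolding fl by (intro triple_Cond) auto
    next
      case 3
      have fl: "(if K = {} then 0 else 1) = (1 :: nat)" "(if \<exists>k\<in>K. {k, v} \<notin> E then 1 else 0) = (0 :: nat)"
        using 3 by auto
      have eq: "alpha_on E (V - {v}) = alpha_on E V" using progress_vertex_done[OF p K 3] .
      have m4': "mark K ?m x = 4 \<longleftrightarrow> x = v" for x using KW m4 by auto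
      have "triple next_vertex
          (conf inp (int n + 1) 0 (mark K ?m) (visited (int n)) [f', vf', 1, 0, 0]) (8 * n + 40) ?Q"
      proof (rule triple_conseq[OF triple_next_vertex[OF sup' vX(1) m4']])
        fix ts'
        assume post: "if v + 1 < int n
          then ts' = conf inp (int n + 1) 0 (marks (v + 1) {}) (visited 0) [f', vf', 1, 0, 0]
          else \<exists>j m c. ts' = conf inp (int n + 1) j m c [f', vf', 1, 0, 1]"
        show "?Q ts'"
        proof (cases "v + 1 < int n")
          case True
          then have "testing (v + 1) {} ts'"
            using post progress_next_vertex(1)[OF p eq True] unfolding testing_def by auto
          then show ?thesis using potential_vertex(2)[OF p] by blast
        next
          case False
          then have stable using progress_next_vertex(2)[OF p eq] by blast
          moreover obtain j m c where "ts' = conf inp (int n + 1) j m c [f', vf', 1, 0, 1]"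
            using post False by auto
          ultimately have "halting ts'" by (simp add: haltingI)
          then show ?thesis ..
        qed
      qed simp
      then show ?thesis unfolding fl by (intro triple_Cond) auto
    qed
  qed
  let ?after = "\<lambda>p K f' vf'. conf inp p 0 (mark K ?m) (visited (int n))
      [f', vf', if K = {} then 0 else 1, if \<exists>k\<in>K. {k, v} \<notin> E then 1 else 0, 0]"
  have rows: "triple (Loop (\<lambda>xs. xs ! 0 \<noteq> 0) row) (conf inp (int n + 1) 0 ?m (visited 0) [f, vf, 0, 0, 0])
    ((n + 1) * (8 * n + 31)) (\<lambda>ts. \<exists>f' vf' K. maximal_clique E (V - {v} - X) K \<and>
      ts = ?after (int n + 1 + int n * int n) K f' vf')"
    using triple_rows[OF sup no2, of f vf 0] unfolding avail m4 by simp
  have rest: "triple (Seq home ?decide) ts' (2 * (n * n) + 12 * n + 70) ?Q"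
    if "\<exists>f' vf' K. maximal_clique E (V - {v} - X) K \<and> ts' = ?after (int n + 1 + int n * int n) K f' vf'" for ts'
    using that
  proof (elim exE conjE)
    fix f' vf' K assume "maximal_clique E (V - {v} - X) K" and ts': "ts' = ?after (int n + 1 + int n * int n) K f' vf'"
    then show ?thesis unfolding ts'
      by (intro triple_Seq'[OF triple_home decide]) auto
  qed
  have init: "triple (assign (\<lambda>i m c fl. (m, c, fl[2 := 0, 3 := 0])) Stay Stay) ts 1
    (\<lambda>ts. ts = conf inp (int n + 1) 0 ?m (visited 0) [f, vf, 0, 0, 0])"
    unfolding ts by (rule triple_assign) auto
  show ?thesis unfolding pass_def
    by (rule triple_Seq'[OF init triple_Seq[OF rows rest]]) (auto simp: algebra_simps)
qed

lemma triple_main: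
  "triple main (conf inp 0 0 (\<lambda>_. 0) (\<lambda>_. 0) [0, 0, 0, 0, 0])
     ((n * (n + 1) + 1) * (10 * (n * n) + 60 * n + 151) + 4 * n + 30)
     (\<lambda>ts. map scan ts ! 7 = 1 \<longleftrightarrow> stable)"
proof -
  let ?fl = "[0, 0, 0, 0, 0] :: nat list" and ?z = "(\<lambda>_. 0) :: int \<Rightarrow> nat"
  define ms where "ms k i = (if 0 \<le> i \<and> i < int k then 1 else 0 :: nat)" for k :: nat and i :: int
  have ms_0: "ms 0 = ?z" by (auto simp: ms_def fun_eq_iff)
  have count: "triple (Loop (\<lambda>xs. xs ! 0 = 2) (assign (\<lambda>i m c fl. (1, c, fl)) Move_Right Move_Right))
    (conf inp 0 0 ?z ?z ?fl) (2 * n + 2) (\<lambda>ts. ts = conf inp (int n) (int n) (ms n) ?z ?fl)"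
  proof (rule triple_for[where N = n and B = 1 and st = "\<lambda>k. conf inp (int k) (int k) (ms k) ?z ?fl"])
    show "triple (assign (\<lambda>i m c fl. (1, c, fl)) Move_Right Move_Right) (conf inp (int k) (int k) (ms k) ?z ?fl) 1
      (\<lambda>ts. ts = conf inp (int (Suc k)) (int (Suc k)) (ms (Suc k)) ?z ?fl)" for k
    proof (rule triple_assign)
      have "ms (Suc k) = (ms k)(int k := 1)" by (auto simp: ms_def fun_eq_iff)
      then show "conf inp (int (Suc k)) (int (Suc k)) (ms (Suc k)) ?z ?fl = conf inp (int k + offset Move_Right)
          (int k + offset Move_Right) ((ms k)(int k := 1)) (?z(int k := ?z (int k))) ?fl"
        by (simp add: add.commute fun_upd_idem)
    qed auto
  qed (auto simp: inp_unary inp_separator ms_0)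
  have z: "?z = visited 0" by (auto simp: visited_def fun_eq_iff)
  have start: "triple (assign (\<lambda>i m c fl. (4, c, fl)) Stay Stay) (conf inp (int n + 1) 0 (ms n) ?z ?fl) 1
    (\<lambda>ts. ts = conf inp (int n + 1) 0 (marks 0 {}) (visited 0) ?fl)"
  proof (rule triple_assign)
    have "marks 0 {} = (ms n)(0 := 4)" using n_pos by (auto simp: ms_def marks_def fun_eq_iff)
    then show "conf inp (int n + 1) 0 (marks 0 {}) (visited 0) ?fl = conf inp (int n + 1 + offset Stay)
        (0 + offset Stay) ((ms n)(0 := 4)) (?z(0 := ?z 0)) ?fl"
      by (simp add: z[symmetric] fun_upd_idem)
  qed auto
  \<comment> \<open>A halting configuration satisfies the invariant for every \<open>k\<close>, so
    the pass that sets the verdict needs only \<open>0 < k\<close>.\<close>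
  let ?I = "\<lambda>k ts. halting ts \<or> (\<exists>v X. testing v X ts \<and> k = potential v X)"
  have loop: "triple (Loop (\<lambda>xs. xs ! 7 = 0) pass) (conf inp (int n + 1) 0 (marks 0 {}) (visited 0) ?fl)
    ((n * (n + 1) + 1) * (10 * (n * n) + 60 * n + 150 + 1)) (\<lambda>ts. map scan ts ! 7 = 1 \<longleftrightarrow> stable)"
  proof (rule triple_Loop[where I = ?I])
    have "testing 0 {} (conf inp (int n + 1) 0 (marks 0 {}) (visited 0) ?fl)"
      using progress_start n_pos by (auto simp: testing_def)
    moreover have "n * (n + 1) = potential 0 {}" by (simp add: potential_def)
    ultimately show "?I (n * (n + 1)) (conf inp (int n + 1) 0 (marks 0 {}) (visited 0) ?fl)" by blast
    show "map scan ts ! 7 = 1 \<longleftrightarrow> stable" if "?I k ts" "\<not> map scan ts ! 7 = 0" for k ts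
    proof -
      have "\<not> testing v X ts" for v X using that(2) by (auto simp: testing_def)
      with that(1) have "halting ts" by blast
      then show ?thesis by (auto simp: halting_def)
    qed
    show "triple pass ts (10 * (n * n) + 60 * n + 150) (\<lambda>ts'. \<exists>k'<k. ?I k' ts')"
      if I: "?I k ts" and c: "map scan ts ! 7 = 0" for k ts
    proof -
      have "\<not> halting ts" using c by (auto simp: halting_def)
      then obtain v X where t: "testing v X ts" "k = potential v X" using I by blast
      then have "0 < k" using potential_vertex(1) by (auto simp: testing_def)
      then show ?thesis
        by (intro triple_conseq[OF triple_pass[OF t(1)]]) (use t(2) in auto)
    qed
  qed
  have sup: "supported (ms n)" by (auto simp: ms_def)
  show ?thesis unfolding main_def
    \<comment> \<open>Counting leaves the input head on the separator; the next move carries it to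
      the first matrix entry.\<close>
    by (rule triple_Seq'[OF count triple_Seq'[OF triple_move triple_Seq'[OF triple_rewind[OF sup]
          triple_Seq'[OF start loop]]]]) (auto simp: algebra_simps)
qed

end
end

section \<open>Graph encodings\<close>

lemma length_concat_matrix: "length (concat (map (\<lambda>u. map (g u) vs) us)) = length us * length vs"
  by (induction us) auto

lemma nth_concat_matrix:
  "i < length us \<Longrightarrow> j < length vs \<Longrightarrow>
    concat (map (\<lambda>u. map (g u) vs) us) ! (i * length vs + j) = g (us ! i) (vs ! j)"
proof (induction us arbitrary: i)
  case (Cons u us)
  then show ?case by (cases i) (auto simp: nth_append add.assoc)
qed simp

lemma
  assumes "finite (verts G)"
  shows length_encode_graph: "length (encode_graph G) = card (verts G) + 1 + card (verts G) * card (verts G)"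
    and encode_graph_unary: "i < card (verts G) \<Longrightarrow> encode_graph G ! i"
    and encode_graph_separator: "\<not> encode_graph G ! card (verts G)"
    and encode_graph_matrix: "i < card (verts G) \<Longrightarrow> j < card (verts G) \<Longrightarrow>
      encode_graph G ! (card (verts G) + 1 + i * card (verts G) + j) \<longleftrightarrow>
        {sorted_list_of_set (verts G) ! i, sorted_list_of_set (verts G) ! j} \<in> edges G"
proof -
  let ?n = "card (verts G)" and ?vs = "sorted_list_of_set (verts G)"
  let ?rows = "concat (map (\<lambda>u. map (\<lambda>v. {u, v} \<in> edges G) ?vs) ?vs)"
  have enc: "encode_graph G = (replicate ?n True @ [False]) @ ?rows"
    by (simp add: encode_graph_def Let_def)
  show "length (encode_graph G) = ?n + 1 + ?n * ?n"
    unfolding enc by (simp add: length_concat_matrix del: length_concat)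
  show "encode_graph G ! i" if "i < ?n" for i
    using that unfolding enc by (simp add: nth_append)
  show "\<not> encode_graph G ! ?n"
    unfolding enc by (simp add: nth_append)
  show "encode_graph G ! (?n + 1 + i * ?n + j) \<longleftrightarrow> {?vs ! i, ?vs ! j} \<in> edges G"
    if "i < ?n" "j < ?n" for i j
    using nth_concat_matrix[of i ?vs j ?vs "\<lambda>u v. {u, v} \<in> edges G"] that
    unfolding enc by (simp add: nth_append)
qed

lemma fst_input_tape_nth: "k < length w \<Longrightarrow> fst (input_tape w) (int k) = (if w ! k then 2 else 1)"
  by (simp add: input_tape_def)

lemma matrix_input_encode:
  assumes fin: "finite (verts G)" and ne: "verts G \<noteq> {}"
  shows "matrix_input (card (verts G)) (fst (input_tape (encode_graph G)))
    (pullback_edges (\<lambda>i. sorted_list_of_set (verts G) ! nat i) (edges G))"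
proof -
  let ?n = "card (verts G)" and ?w = "encode_graph G"
  note len = length_encode_graph[OF fin]
  have n_less: "?n < length ?w" by (simp add: len)
  show ?thesis
  proof
    show "1 \<le> ?n" using fin ne by (simp add: Suc_leI card_gt_0_iff)
    show "fst (input_tape ?w) i \<noteq> 0 \<longleftrightarrow> 0 \<le> i \<and> i < int ?n + 1 + int ?n * int ?n" for i
      by (auto simp: input_tape_def len)
    show "fst (input_tape ?w) i = 2" if "0 \<le> i" "i < int ?n" for i
    proof -
      have "i < int (length ?w)" "nat i < ?n" using that n_less by linarith+
      then show ?thesis using that encode_graph_unary[OF fin] by (simp add: input_tape_def)
    qed
    show "fst (input_tape ?w) (int ?n) = 1"
      using encode_graph_separator[OF fin] n_less by (simp add: input_tape_def)
    show "fst (input_tape ?w) (int ?n + 1 + i * int ?n + j) =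
        (if {i, j} \<in> pullback_edges (\<lambda>i. sorted_list_of_set (verts G) ! nat i) (edges G) then 2 else 1)"
      if "0 \<le> i" "i < int ?n" "0 \<le> j" "j < int ?n" for i j
    proof -
      define a b where "a = nat i" and "b = nat j"
      have ab: "i = int a" "j = int b" "a < ?n" "b < ?n"
        using that by (auto simp: a_def b_def)
      let ?k = "?n + 1 + a * ?n + b"
      \<comment> \<open>Keeps the index inside the word; beyond it the tape would read
        blank.\<close>
      have "a * ?n + b < ?n * ?n"
      proof -
        have "a * ?n + b < Suc a * ?n" using ab(4) by simp
        also have "\<dots> \<le> ?n * ?n" using ab(3) by (intro mult_le_mono1) simp
        finally show ?thesis .
      qed
      then have "?k < length ?w" by (simp add: len)
      moreover have "int ?n + 1 + i * int ?n + j = int ?k" using ab by simp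
      ultimately have "fst (input_tape ?w) (int ?n + 1 + i * int ?n + j) = (if ?w ! ?k then 2 else 1)"
        by (simp only: fst_input_tape_nth)
      then show ?thesis using encode_graph_matrix[OF fin ab(3,4)] ab by simp
    qed
  qed
qed

lemma bij_betw_sorted_list:
  assumes "finite A"
  shows "bij_betw (\<lambda>i. sorted_list_of_set A ! nat i) {0..<int (card A)} A"
proof -
  have "bij_betw nat {0..<int (card A)} {..<card A}"
    by (rule bij_betwI[where g = int]) auto
  moreover have "bij_betw ((!) (sorted_list_of_set A)) {..<card A} A"
    using assms by (intro bij_betw_nth) auto
  ultimately show ?thesis
    using bij_betw_trans by (fastforce simp: comp_def)
qed

text \<open>Reindexing is a bijection from \<open>V\<close> onto the vertices, and deleting
  \<open>f w\<close> from \<open>G\<close> corresponds to deleting \<open>w\<close> from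
  \<open>V\<close>, so independence numbers agree pairwise.\<close>

lemma stable_iff:
  fixes G :: "nat graph"
  assumes "cograph G"
  defines "f \<equiv> \<lambda>i. sorted_list_of_set (verts G) ! nat i"
  shows "matrix_input.stable (card (verts G)) (pullback_edges f (edges G)) \<longleftrightarrow> G \<in> alpha_VertexStability"
proof -
  interpret matrix_input "card (verts G)" "fst (input_tape (encode_graph G))" "pullback_edges f (edges G)"
    unfolding f_def using assms cograph_finite cograph_nonempty by (intro matrix_input_encode)
  have bij: "bij_betw f V (verts G)"
    unfolding f_def using bij_betw_sorted_list[OF cograph_finite[OF assms(1)]] .
  have inj: "inj_on f V" and img: "f ` V = verts G" using bij by (auto simp: bij_betw_def)
  have "alpha_on (pullback_edges f (edges G)) V = independence_number G"
    using alpha_on_image[OF inj] by (simp add: img independence_number_alpha_on)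
  moreover have "alpha_on (pullback_edges f (edges G)) (V - {w}) = independence_number (delete_vertex G (f w))"
    if "w \<in> V" for w
  proof -
    have "f ` (V - {w}) = verts G - {f w}"
      using inj_on_image_set_diff[OF inj, of V "{w}"] that img by auto
    moreover have "inj_on f (V - {w})" using inj by (rule inj_on_diff)
    ultimately show ?thesis using alpha_on_image[of f "V - {w}"] by (simp add: alpha_on_delete_vertex)
  qed
  ultimately have "stable \<longleftrightarrow> (\<forall>w\<in>V. independence_number (delete_vertex G (f w)) = independence_number G)"
    by (simp add: stable_def)
  also have "\<dots> \<longleftrightarrow> (\<forall>v\<in>f ` V. independence_number (delete_vertex G v) = independence_number G)"
    by simp
  also have "\<dots> \<longleftrightarrow> alpha_vertex_stable G"
    unfolding img alpha_vertex_stable_def ..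
  finally show ?thesis using cograph_simple[OF assms(1)] by (simp add: alpha_VertexStability_def)
qed

text \<open>Seven blank tapes: the two position tapes and the five flags, all initially 0.\<close>

lemma initial_conf:
  "input_tape w # replicate 7 blank_tape = conf (fst (input_tape w)) 0 0 (\<lambda>_. 0) (\<lambda>_. 0) [0, 0, 0, 0, 0]"
proof -
  have "flag_tape 0 = blank_tape" by (auto simp: flag_tape_def blank_tape_def)
  then show ?thesis by (simp add: conf_def numeral_eq_Suc blank_tape_def input_tape_def)
qed

theorem theorem18:
  shows "in_P_for alpha_VertexStability {G. cograph G}"
proof -
  let ?B = "\<lambda>n :: nat. (n * (n + 1) + 1) * (10 * (n * n) + 60 * n + 151) + 4 * n + 30"
  define x :: "nat poly" where "x = [:0, 1:]"
  \<comment> \<open>The bound of \<open>triple_main\<close> as a polynomial. The constant 31 instead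
    of 30 is the verdict step added by \<open>compile\<close>.\<close>
  define P where "P = (x * (x + 1) + 1) * ([:10:] * (x * x) + [:60:] * x + [:151:]) + [:4:] * x + [:31:]"
  have P: "poly P n = ?B n + 1" for n by (simp add: P_def x_def algebra_simps)
  obtain M where M: "turing_machine M"
    "\<And>w B R. triple main (input_tape w # replicate (8 - 1) blank_tape) B (\<lambda>ts. map scan ts ! 7 = 1 \<longleftrightarrow> R) \<Longrightarrow>
      (R \<longrightarrow> accepts_within M w (B + 1)) \<and> (\<not> R \<longrightarrow> rejects_within M w (B + 1))"
    using compile[OF well_formed_main, of "\<lambda>xs. xs ! 7 = 1"] by auto
  have "(G \<in> alpha_VertexStability \<longrightarrow> accepts_within M w (poly P (length w))) \<and>
      (G \<notin> alpha_VertexStability \<longrightarrow> rejects_within M w (poly P (length w)))"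
    if G: "cograph G" and w: "w = encode_graph G" for G w
  proof -
    let ?f = "\<lambda>i. sorted_list_of_set (verts G) ! nat i" and ?n = "card (verts G)"
    interpret matrix_input ?n "fst (input_tape w)" "pullback_edges ?f (edges G)"
      unfolding w using G cograph_finite cograph_nonempty by (intro matrix_input_encode)
    have bij: "bij_betw ?f V (verts G)" using bij_betw_sorted_list[OF cograph_finite[OF G]] .
    then have "cliques_meet_indeps (pullback_edges ?f (edges G)) V"
      using cograph_cliques_meet_indeps[OF G]
      by (intro cliques_meet_indeps_pullback) (auto simp: bij_betw_def)
    note run = triple_main[OF this, folded initial_conf]
    have n: "?n \<le> length w" using length_encode_graph[OF cograph_finite[OF G]] w by simp
    \<comment> \<open>The bound is monotone, so it may be stated in the length of the encoding,
      which is at least the number of vertices.\<close>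
    have "?B ?n \<le> ?B (length w)"
      by (intro add_le_mono mult_le_mono n order_refl)
    then have "triple main (input_tape w # replicate (8 - 1) blank_tape) (?B (length w))
        (\<lambda>ts. map scan ts ! 7 = 1 \<longleftrightarrow> G \<in> alpha_VertexStability)"
      using triple_conseq[OF run] stable_iff[OF G] by simp
    from M(2)[OF this] show ?thesis unfolding P .
  qed
  then show ?thesis using M(1) unfolding in_P_for_def Let_def by blast
qed

end
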